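(* Let $\omega\in[0,N]$ and $\xi\in\Xi_N$. (a) If $\omega\in[0,N]\setminus\mathbb Z$, then $\mathcal A_\omega(\cdot\,;2\pi)$ attains its minimum on the set of loops in $\Lambda^{D_N}_\xi$ satisfying $[z_0]=0$. (b) If $\omega\in\{0,N\}$, then $\mathcal A_\omega(\cdot\,;2\pi)$ attains its minimum on the set of loops in $\Lambda^{D_N}_\xi$ satisfying $[x_0]=0$ and $[z_0]=0$.
   Context: Fix an integer $N\ge2$ and let $\mathbf N=\{0,\dots,N-1\}$. Consider unit masses with positions $q_i=(x_i,y_i,z_i)\in\mathbb R^3$, and write $\zeta_i=x_i+\mathrm i y_i\in\mathbb C$, so that $q_i=(\zeta_i,z_i)$. - Potential: $U(q)=\sum_{i<j}1/|q_i-q_j|$. - Collision set: $\Delta=\{q:q_i=q_j\text{ for some }i\ne j\}$. - Loop space: $\Lambda=H^1(\mathbb R/2\pi\mathbb Z,\mathbb R^{3N})$. - Rotating-frame action: for $\omega\in\mathbb R$, $\mathcal A_\omega(q;T_1,T_2)=\int_{T_1}^{T_2}\big(\tfrac12\sum_i(|\dot\zeta_i+\mathrm i\omega\zeta_i|^2+\dot z_i^2)+U(q)\big)dt$, and $\mathcal A_\omega(q;T)=\mathcal A_\omega(q;0,T)$. (This is the action in a frame rotating about the $z$-axis with angular velocity $\omega$.) - Means: $[x_0]=\frac1{2\pi}\int_0^{2\pi}x_0$ and $[z_0]=\frac1{2\pi}\int_0^{2\pi}z_0$. - Reflection: $\mathfrak R_{xz}(x,y,z)=(x,-y,z)$. -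 $D_N$-symmetric loops: $\Lambda^{D_N}=\{q\in\Lambda: q_i(t)=q_0(t+2\pi i/N),\ q_0(2\pi-t)=\mathfrak R_{xz}q_0(t)\ \forall t\}$. - Sign data: for collision-free $q\in\Lambda^{D_N}$, $y_0(k\pi/N)\ne0$ for $k=1,\dots,N-1$. Let $\Xi_N=\{\pm1\}^{N-1}$. - Topological classes: $\Lambda^{D_N}_\xi$ is the weak $H^1$-closure in $\Lambda^{D_N}$ of the collision-free $q\in\Lambda^{D_N}$ with $\operatorname{sign}y_0(k\pi/N)=\xi_k$ for all $k$. *)

theory Defs
  imports "HOL-Analysis.Analysis"
begin

text \<open>A loop configuration: body index i (only i < N matters) and time t;
  q i t = (zeta_i(t), z_i(t)) in C x R = R^3.\<close>
type_synonym loop = "nat \<Rightarrow> real \<Rightarrow> complex \<times> real"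

definition is_wderiv :: "(real \<Rightarrow> 'a::euclidean_space) \<Rightarrow> (real \<Rightarrow> 'a) \<Rightarrow> bool" where
  "is_wderiv f g \<longleftrightarrow> g \<in> borel_measurable lborel
     \<and> (\<forall>a b. set_integrable lborel {a..b} g)
     \<and> set_integrable lborel {0..2*pi} (\<lambda>t. (norm (g t))^2)
     \<and> (\<forall>a b. a \<le> b \<longrightarrow> f b - f a = (LINT t:{a..b}|lborel. g t))"

text \<open>2pi-periodic H^1 function (continuous representative).\<close>
definition H1_loop :: "(real \<Rightarrow> 'a::euclidean_space) \<Rightarrow> bool" where
  "H1_loop f \<longleftrightarrow> (\<forall>t. f (t + 2*pi) = f t) \<and> (\<exists>g. is_wderiv f g)"

definition wderiv :: "(real \<Rightarrow> 'a::euclidean_space) \<Rightarrow> real \<Rightarrow> 'a" where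
  "wderiv f = (SOME g. is_wderiv f g)"

definition in_Lambda :: "nat \<Rightarrow> loop \<Rightarrow> bool" where
  "in_Lambda N q \<longleftrightarrow> (\<forall>i<N. H1_loop (q i))"

definition H1_inner :: "nat \<Rightarrow> loop \<Rightarrow> loop \<Rightarrow> real" where
  "H1_inner N q p = (\<Sum>i<N. LINT t:{0..2*pi}|lborel.
      (q i t \<bullet> p i t + wderiv (q i) t \<bullet> wderiv (p i) t))"

definition refl_xz :: "complex \<times> real \<Rightarrow> complex \<times> real" where
  "refl_xz w = (cnj (fst w), snd w)"

definition Lambda_DN :: "nat \<Rightarrow> loop \<Rightarrow> bool" where
  "Lambda_DN N q \<longleftrightarrow> in_Lambda N q
     \<and> (\<forall>i<N. \<forall>t. q i t = q 0 (t + 2*pi*real i / real N))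
     \<and> (\<forall>t. q 0 (2*pi - t) = refl_xz (q 0 t))"

definition collision_free :: "nat \<Rightarrow> loop \<Rightarrow> bool" where
  "collision_free N q \<longleftrightarrow> (\<forall>t. \<forall>i<N. \<forall>j<N. i \<noteq> j \<longrightarrow> q i t \<noteq> q j t)"

definition DN_core :: "nat \<Rightarrow> (nat \<Rightarrow> real) \<Rightarrow> loop set" where
  "DN_core N \<xi> = {q. Lambda_DN N q \<and> collision_free N q \<and>
     (\<forall>k\<in>{1..N-1}. sgn (Im (fst (q 0 (real k * pi / real N)))) = \<xi> k)}"

text \<open>Closure in Lambda^{D_N} for the weak H^1 topology (topological, via
  basic weak neighbourhoods given by finitely many test loops).\<close>
definition weak_closure_DN :: "nat \<Rightarrow> loop set \<Rightarrow> loop set" where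
  "weak_closure_DN N S = {q. Lambda_DN N q \<and>
     (\<forall>H. finite H \<longrightarrow> H \<subseteq> {h. in_Lambda N h} \<longrightarrow>
        (\<forall>\<epsilon>>0. \<exists>p\<in>S. \<forall>h\<in>H. \<bar>H1_inner N p h - H1_inner N q h\<bar> < \<epsilon>))}"

definition Lambda_DN_xi :: "nat \<Rightarrow> (nat \<Rightarrow> real) \<Rightarrow> loop set" where
  "Lambda_DN_xi N \<xi> = weak_closure_DN N (DN_core N \<xi>)"

definition potential :: "nat \<Rightarrow> (nat \<Rightarrow> complex \<times> real) \<Rightarrow> ennreal" where
  "potential N x = (if \<exists>i<N. \<exists>j<N. i \<noteq> j \<and> x i = x j then \<infinity>
     else (\<Sum>i<N. \<Sum>j\<in>{i<..<N}. ennreal (1 / norm (x i - x j))))"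

definition action :: "nat \<Rightarrow> real \<Rightarrow> loop \<Rightarrow> real \<Rightarrow> real \<Rightarrow> ennreal" where
  "action N \<omega> q T1 T2 = (\<integral>\<^sup>+ t \<in> {T1..T2}.
      (ennreal (1/2 * (\<Sum>i<N. (cmod (fst (wderiv (q i) t) + \<i> * complex_of_real \<omega> * fst (q i t)))^2
                               + (snd (wderiv (q i) t))^2))
       + potential N (\<lambda>i. q i t)) \<partial>lborel)"

definition mean_x0 :: "loop \<Rightarrow> real" where
  "mean_x0 q = 1 / (2*pi) * (LINT t:{0..2*pi}|lborel. Re (fst (q 0 t)))"

definition mean_z0 :: "loop \<Rightarrow> real" where
  "mean_z0 q = 1 / (2*pi) * (LINT t:{0..2*pi}|lborel. snd (q 0 t))"

end

theory Submission
  imports Defs "HOL-Complex_Analysis.Great_Picard"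
begin

text \<open>The direct method. A bound on the action bounds the rotating-frame velocity
  \<open>\<zeta>' + \<i>\<omega>\<zeta>\<close> in \<open>L\<^sup>2\<close>. Variation of constants turns this into a bound on \<open>(exp (2\<pi>\<i>\<omega>) - 1) \<zeta>\<^sub>0(0)\<close> and
  on the oscillation of \<open>\<zeta>\<^sub>0\<close>, which is coercive if \<open>\<omega>\<close> is not an integer. For \<open>\<omega> = 0\<close> the mean of \<open>x\<^sub>0\<close>
  supplies the missing control, and for \<open>\<omega> = N\<close> one first subtracts the symmetry \<open>\<zeta>\<^sub>0(0) exp (- \<i>Nt)\<close>.
  A minimising sequence then converges uniformly along a subsequence by Arzela-Ascoli, its derivatives
  converge weakly in \<open>L\<^sup>2\<close> by Mazur's convexity argument, and the action is lower semicontinuous by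
  convexity of the kinetic part and Fatou's lemma for the potential. The class is nonempty because
  \<open>(\<i> sin t P(cos t), cos t)\<close> is collision-free with prescribed signs for a suitable interpolation
  polynomial \<open>P\<close>.\<close>

section \<open>Square-integrable functions\<close>

text \<open>The kinetic part cannot see multiples of \<open>exp (- \<i>\<omega>t)\<close>, the
  solutions of \<zeta>' = - \<i>\<omega>\<zeta>, and these are 2\<pi>-periodic exactly if \<omega>
  is an integer. Adding one to body 0 and its time shifts displaces body i with the extra phase
  \<open>exp (- 2\<pi>\<i>\<omega>i/N)\<close>. The displacement is common to all bodies, hence
  invisible to the potential too, exactly if N divides \<omega>. In [0, N] this leaves 0, where the
  mean of x_0 detects the displacement (the reflection settles y_0), and N, where the mean is blind
  to it. Constants are always in the kernel of the vertical motion, whence the condition on z_0. Two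
  features of the setting shape the rest. \<open>wderiv\<close> is an arbitrary choice, so
  identities between derivatives hold only a.e., and it lives on the whole line, so a limit found on
  one period has to be extended. The action is \<open>ennreal\<close>-valued and limits may collide,
  so estimates are arranged without subtracting from it.\<close>

definition sq_integrable :: "'a measure \<Rightarrow> ('a \<Rightarrow> 'b::euclidean_space) \<Rightarrow> bool" where
  "sq_integrable M f \<longleftrightarrow> f \<in> borel_measurable M \<and> integrable M (\<lambda>x. (norm (f x))\<^sup>2)"

definition energy :: "'a measure \<Rightarrow> ('a \<Rightarrow> 'b::euclidean_space) \<Rightarrow> real" where
  "energy M f = (\<integral>x. (norm (f x))\<^sup>2 \<partial>M)"

lemma sq_integrable_measurable: "sq_integrable M f \<Longrightarrow> f \<in> borel_measurable M"
  by (simp add: sq_integrable_def)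

lemma sq_integrable_norm_square: "sq_integrable M f \<Longrightarrow> integrable M (\<lambda>x. (norm (f x))\<^sup>2)"
  by (simp add: sq_integrable_def)

lemma energy_nonneg: "0 \<le> energy M f"
  by (simp add: energy_def)

lemma sq_integrable_inner:
  assumes f: "sq_integrable M f" and g: "sq_integrable M g"
  shows "integrable M (\<lambda>x. f x \<bullet> g x)"
proof (rule Bochner_Integration.integrable_bound)
  show "integrable M (\<lambda>x. (norm (f x))\<^sup>2 + (norm (g x))\<^sup>2)"
    using f g by (simp add: sq_integrable_def)
  show "(\<lambda>x. f x \<bullet> g x) \<in> borel_measurable M"
    using f g by (auto simp: sq_integrable_def intro: borel_measurable_inner)
  have "norm (a \<bullet> b) \<le> norm ((norm a)\<^sup>2 + (norm b)\<^sup>2)" for a b :: 'b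
  proof -
    have "\<bar>a \<bullet> b\<bar> \<le> norm a * norm b" by (rule Cauchy_Schwarz_ineq2)
    also have "\<dots> \<le> (norm a)\<^sup>2 + (norm b)\<^sup>2"
      using sum_squares_bound[of "norm a" "norm b"] mult_nonneg_nonneg[OF norm_ge_zero norm_ge_zero, of a b]
      by (simp only: mult.assoc)
    finally show ?thesis by simp
  qed
  then show "AE x in M. norm (f x \<bullet> g x) \<le> norm ((norm (f x))\<^sup>2 + (norm (g x))\<^sup>2)"
    by blast
qed

lemma sq_integrable_scaleR:
  assumes "sq_integrable M f"
  shows "sq_integrable M (\<lambda>x. c *\<^sub>R f x)"
  using assms by (auto simp: sq_integrable_def power_mult_distrib)

lemma norm_add_square: "(norm (a + b))\<^sup>2 = (norm a)\<^sup>2 + 2 * (a \<bullet> b) + (norm b)\<^sup>2"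
  for a b :: "'b::real_inner"
  by (simp add: power2_norm_eq_inner inner_simps inner_commute)

lemma sq_integrable_add:
  assumes f: "sq_integrable M f" and g: "sq_integrable M g"
  shows "sq_integrable M (\<lambda>x. f x + g x)"
  using f g sq_integrable_inner[OF f g] by (auto simp: sq_integrable_def norm_add_square)

lemma sq_integrable_diff:
  assumes f: "sq_integrable M f" and g: "sq_integrable M g"
  shows "sq_integrable M (\<lambda>x. f x - g x)"
  using sq_integrable_add[OF f sq_integrable_scaleR[OF g, of "-1"]] by simp

lemma energy_add:
  assumes f: "sq_integrable M f" and g: "sq_integrable M g"
  shows "energy M (\<lambda>x. f x + g x) = energy M f + 2 * (\<integral>x. f x \<bullet> g x \<partial>M) + energy M g"
  using f g sq_integrable_inner[OF f g] by (simp add: sq_integrable_def energy_def norm_add_square)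

lemma energy_scaleR: "energy M (\<lambda>x. c *\<^sub>R f x) = c\<^sup>2 * energy M f"
  by (simp add: energy_def power_mult_distrib)

lemma energy_diff:
  assumes f: "sq_integrable M f" and g: "sq_integrable M g"
  shows "energy M (\<lambda>x. f x - g x) = energy M f - 2 * (\<integral>x. f x \<bullet> g x \<partial>M) + energy M g"
  using energy_add[OF f sq_integrable_scaleR[OF g, of "-1"]] energy_scaleR[of M "-1" g] by simp

lemma energy_parallelogram:
  assumes f: "sq_integrable M f" and g: "sq_integrable M g"
  shows "energy M (\<lambda>x. f x - g x) =
    2 * energy M f + 2 * energy M g - 4 * energy M (\<lambda>x. (1/2) *\<^sub>R (f x + g x))"
  using energy_add[OF f g] energy_diff[OF f g] energy_scaleR[of M "1/2" "\<lambda>x. f x + g x"]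
  by (simp add: power2_eq_square)

lemma energy_add_le:
  assumes f: "sq_integrable M f" and g: "sq_integrable M g"
  shows "energy M (\<lambda>x. f x + g x) \<le> 2 * energy M f + 2 * energy M g"
  using energy_add[OF f g] energy_diff[OF f g] energy_nonneg[of M "\<lambda>x. f x - g x"] by simp

text \<open>The value at the vertex \<open>b / c\<close> of the parabola decides; a parabola
  degenerated to a line must be constant.\<close>

lemma discriminant_le:
  fixes a b c :: real
  assumes "\<And>t. 0 \<le> a - 2 * t * b + t\<^sup>2 * c" "0 \<le> c"
  shows "b\<^sup>2 \<le> a * c"
proof (cases "c = 0")
  case True
  have "b = 0"
  proof (rule ccontr)
    assume "b \<noteq> 0"
    \<comment> \<open>At this \<open>t\<close> the linear expression \<open>a - 2 * t * b\<close>
      equals -1.\<close>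
    then show False using assms(1)[of "(a + 1) / (2 * b)"] True by simp
  qed
  then show ?thesis using True by simp
next
  case False
  then have "c > 0" using assms(2) by simp
  have "0 \<le> c * (a - 2 * (b / c) * b + (b / c)\<^sup>2 * c)"
    using assms(1)[of "b / c"] \<open>c > 0\<close> by simp
  also have "\<dots> = a * c - b\<^sup>2"
    using \<open>c > 0\<close> by (simp add: field_simps power2_eq_square)
  finally show ?thesis by simp
qed

lemma inner_integral_Cauchy_Schwarz:
  assumes f: "sq_integrable M f" and g: "sq_integrable M g"
  shows "(\<integral>x. f x \<bullet> g x \<partial>M)\<^sup>2 \<le> energy M f * energy M g"
proof (rule discriminant_le)
  fix t :: real
  have "0 \<le> energy M (\<lambda>x. f x - t *\<^sub>R g x)" by (rule energy_nonneg)
  also have "\<dots> = energy M f - 2 * t * (\<integral>x. f x \<bullet> g x \<partial>M) + t\<^sup>2 * energy M g"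
    using energy_diff[OF f sq_integrable_scaleR[OF g, of t]] energy_scaleR[of M t g] by simp
  finally show "0 \<le> energy M f - 2 * t * (\<integral>x. f x \<bullet> g x \<partial>M) + t\<^sup>2 * energy M g" .
qed (rule energy_nonneg)

lemma sq_integrable_const:
  assumes "finite_measure M"
  shows "sq_integrable M (\<lambda>x. c)"
proof -
  interpret finite_measure M by fact
  show ?thesis by (simp add: sq_integrable_def)
qed

lemma sq_integrable_norm:
  "sq_integrable M f \<Longrightarrow> sq_integrable M (\<lambda>x. norm (f x))"
  by (auto simp: sq_integrable_def)

lemma energy_norm: "energy M (\<lambda>x. norm (f x)) = energy M f"
  by (simp add: energy_def)

lemma sq_integrable_integrable_norm:
  assumes "finite_measure M" "sq_integrable M f"
  shows "integrable M (\<lambda>x. norm (f x))"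
  using sq_integrable_inner[OF sq_integrable_norm[OF assms(2)] sq_integrable_const[OF assms(1), of 1]]
  by simp

lemma sq_integrable_integrable:
  assumes "finite_measure M" "sq_integrable M f"
  shows "integrable M f"
  using sq_integrable_integrable_norm[OF assms] assms(2)
  by (simp add: sq_integrable_def integrable_norm_iff)

lemma integral_norm_le_energy:
  assumes "finite_measure M" "sq_integrable M f"
  shows "(\<integral>x. norm (f x) \<partial>M) \<le> sqrt (measure M (space M) * energy M f)"
proof (rule real_le_rsqrt)
  have "energy M (\<lambda>x. 1 :: real) = measure M (space M)"
    by (simp add: energy_def)
  then show "(\<integral>x. norm (f x) \<partial>M)\<^sup>2 \<le> measure M (space M) * energy M f"
    using inner_integral_Cauchy_Schwarz[OF sq_integrable_norm[OF assms(2)] sq_integrable_const[OF assms(1), of "1::real"]]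
    by (simp add: energy_norm mult.commute)
qed

section \<open>Strong limits and completeness of L2\<close>

lemma inner_integral_tendsto:
  assumes u: "\<And>n. sq_integrable M (u n)" and g: "sq_integrable M g" and \<psi>: "sq_integrable M \<psi>"
    and lim: "(\<lambda>n. energy M (\<lambda>x. u n x - g x)) \<longlonglongrightarrow> 0"
  shows "(\<lambda>n. \<integral>x. u n x \<bullet> \<psi> x \<partial>M) \<longlonglongrightarrow> (\<integral>x. g x \<bullet> \<psi> x \<partial>M)"
proof -
  have *: "norm ((\<integral>x. u n x \<bullet> \<psi> x \<partial>M) - (\<integral>x. g x \<bullet> \<psi> x \<partial>M))
      \<le> sqrt (energy M (\<lambda>x. u n x - g x) * energy M \<psi>)" for n
  proof -
    have "(\<integral>x. u n x \<bullet> \<psi> x \<partial>M) - (\<integral>x. g x \<bullet> \<psi> x \<partial>M) = (\<integral>x. (u n x - g x) \<bullet> \<psi> x \<partial>M)"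
      using sq_integrable_inner[OF u \<psi>] sq_integrable_inner[OF g \<psi>]
      by (simp add: inner_diff_left)
    then show ?thesis
      using inner_integral_Cauchy_Schwarz[OF sq_integrable_diff[OF u g] \<psi>]
      by (simp add: real_le_rsqrt)
  qed
  have "(\<lambda>n. sqrt (energy M (\<lambda>x. u n x - g x) * energy M \<psi>)) \<longlonglongrightarrow> sqrt (0 * energy M \<psi>)"
    by (intro tendsto_intros lim)
  then have "(\<lambda>n. (\<integral>x. u n x \<bullet> \<psi> x \<partial>M) - (\<integral>x. g x \<bullet> \<psi> x \<partial>M)) \<longlonglongrightarrow> 0"
    by (intro Lim_null_comparison[OF always_eventually, OF allI, OF *]) simp
  then show ?thesis by (simp add: LIM_zero_iff)
qed

text \<open>Riesz-Fischer: a subsequence whose increments have energy at most 4^-j has absolutely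
  summable increments a.e., because their L1 norms are O(2^-j) on a finite measure space. Fatou's
  lemma then turns the a.e. limit of the subsequence into an L2 limit of the whole sequence.\<close>

lemma sq_integrable_complete:
  fixes u :: "nat \<Rightarrow> 'a \<Rightarrow> 'b::euclidean_space"
  assumes fin: "finite_measure M" and u: "\<And>n. sq_integrable M (u n)"
    and Cauchy: "\<And>e. 0 < e \<Longrightarrow> \<exists>k. \<forall>m\<ge>k. \<forall>n\<ge>k. energy M (\<lambda>x. u m x - u n x) \<le> e"
  obtains g where "sq_integrable M g" "(\<lambda>n. energy M (\<lambda>x. u n x - g x)) \<longlonglongrightarrow> 0"
proof -
  interpret finite_measure M by fact
  have [measurable]: "u n \<in> borel_measurable M" for n
    using u by (simp add: sq_integrable_def)
  have "\<exists>k. \<forall>j. \<forall>m\<ge>k j. \<forall>n\<ge>k j. energy M (\<lambda>x. u m x - u n x) \<le> (1/4)^j"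
    by (rule choice) (use Cauchy in auto)
  then obtain K where K: "\<And>j m n. m \<ge> K j \<Longrightarrow> n \<ge> K j \<Longrightarrow> energy M (\<lambda>x. u m x - u n x) \<le> (1/4)^j"
    by blast
  \<comment> \<open>Summing makes \<open>r j\<close> dominate every \<open>K i\<close> with
    \<open>i \<le> j\<close>, without any monotonicity of \<open>K\<close>.\<close>
  define r where "r j = (\<Sum>i\<le>j. K i)" for j
  have r: "K i \<le> r j" if "i \<le> j" for i j
    unfolding r_def using that by (intro member_le_sum) auto
  define d where "d j x = u (r (Suc j)) x - u (r j) x" for j x
  have [measurable]: "d j \<in> borel_measurable M" for j
    unfolding d_def by measurable
  have d_sq: "sq_integrable M (d j)" for j
    unfolding d_def by (intro sq_integrable_diff u)
  define \<mu> where "\<mu> = sqrt (measure M (space M))"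
  have d_norm: "(\<integral>x. norm (d j x) \<partial>M) \<le> \<mu> * (1/2)^j" for j
  proof -
    have "energy M (d j) \<le> (1/4)^j"
      unfolding d_def by (intro K r) auto
    then have "sqrt (measure M (space M) * energy M (d j)) \<le> sqrt (measure M (space M) * (1/4)^j)"
      by (simp add: mult_left_mono)
    also have "\<dots> = \<mu> * (1/2)^j"
      by (simp add: \<mu>_def real_sqrt_mult real_sqrt_power real_sqrt_divide)
    finally show ?thesis
      using integral_norm_le_energy[OF fin d_sq, of j] by simp
  qed
  have "(\<integral>\<^sup>+x. (\<Sum>j. ennreal (norm (d j x))) \<partial>M) = (\<Sum>j. \<integral>\<^sup>+x. ennreal (norm (d j x)) \<partial>M)"
    by (intro nn_integral_suminf) auto
  also have "\<dots> \<le> (\<Sum>j. ennreal (\<mu> * (1/2)^j))"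
    using d_norm sq_integrable_integrable_norm[OF fin d_sq]
    by (intro suminf_le summableI) (simp add: nn_integral_eq_integral ennreal_leI)
  also have "\<dots> = ennreal (\<Sum>j. \<mu> * (1/2)^j)"
    by (intro suminf_ennreal2 summable_mult summable_geometric) (auto simp: \<mu>_def)
  finally have "(\<integral>\<^sup>+x. (\<Sum>j. ennreal (norm (d j x))) \<partial>M) \<noteq> \<infinity>"
    by (auto simp: top_unique)
  then have "AE x in M. (\<Sum>j. ennreal (norm (d j x))) \<noteq> \<infinity>"
    by (intro nn_integral_PInf_AE) auto
  then have conv: "AE x in M. convergent (\<lambda>j. u (r j) x)"
  proof eventually_elim
    case (elim x)
    then have "summable (\<lambda>j. norm (d j x))"
      by (intro summable_suminf_not_top) (auto simp: top_ennreal_def)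
    then have "summable (\<lambda>j. d j x)"
      by (rule summable_norm_cancel)
    then have "convergent (\<lambda>n. \<Sum>j<n. d j x)"
      by (simp add: summable_iff_convergent)
    moreover have "(\<Sum>j<n. d j x) = u (r n) x - u (r 0) x" for n
      unfolding d_def using sum_lessThan_telescope[of "\<lambda>j. u (r j) x" n] by simp
    ultimately have "convergent (\<lambda>n. (u (r n) x - u (r 0) x) + u (r 0) x)"
      by (intro convergent_add convergent_const) simp
    then show ?case by simp
  qed
  define g where "g x = lim (\<lambda>j. u (r j) x)" for x
  have [measurable]: "g \<in> borel_measurable M"
    unfolding g_def by measurable
  \<comment> \<open>Fatou in \<open>j\<close> with \<open>n\<close> fixed: from \<open>j = i\<close>
    on, the integrals are at most 4^-i.\<close>
  have bound: "(\<integral>\<^sup>+x. ennreal ((norm (u n x - g x))\<^sup>2) \<partial>M) \<le> ennreal ((1/4)^i)" if n: "n \<ge> K i" for n i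
  proof -
    have "(\<integral>\<^sup>+x. ennreal ((norm (u n x - g x))\<^sup>2) \<partial>M)
        = (\<integral>\<^sup>+x. liminf (\<lambda>j. ennreal ((norm (u n x - u (r j) x))\<^sup>2)) \<partial>M)"
    proof (intro nn_integral_cong_AE, use conv in eventually_elim)
      case (elim x)
      then have "(\<lambda>j. u (r j) x) \<longlonglongrightarrow> g x"
        by (simp add: g_def convergent_LIMSEQ_iff)
      then have "(\<lambda>j. ennreal ((norm (u n x - u (r j) x))\<^sup>2)) \<longlonglongrightarrow> ennreal ((norm (u n x - g x))\<^sup>2)"
        by (intro tendsto_ennrealI tendsto_intros)
      then show ?case
        using lim_imp_Liminf by force
    qed
    also have "\<dots> \<le> liminf (\<lambda>j. \<integral>\<^sup>+x. ennreal ((norm (u n x - u (r j) x))\<^sup>2) \<partial>M)"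
      by (intro nn_integral_liminf) measurable
    also have "\<dots> \<le> ennreal ((1/4)^i)"
    proof (rule Liminf_le)
      show "\<forall>\<^sub>F j in sequentially. (\<integral>\<^sup>+x. ennreal ((norm (u n x - u (r j) x))\<^sup>2) \<partial>M) \<le> ennreal ((1/4)^i)"
        using eventually_ge_at_top[of i]
      proof eventually_elim
        case (elim j)
        have "energy M (\<lambda>x. u n x - u (r j) x) \<le> (1/4)^i"
          by (intro K n r elim)
        then show ?case
          using sq_integrable_norm_square[OF sq_integrable_diff[OF u u, of n "r j"]]
          by (simp add: nn_integral_eq_integral energy_def ennreal_leI)
      qed
    qed auto
    finally show ?thesis .
  qed
  have diff_sq: "sq_integrable M (\<lambda>x. u n x - g x)" if "n \<ge> K i" for n i
    unfolding sq_integrable_def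
    using bound[OF that] by (auto intro!: integrableI_bounded simp: order_le_less_trans[OF _ ennreal_less_top])
  have g_sq: "sq_integrable M g"
    using sq_integrable_diff[OF u[of "K 0"] diff_sq[of 0 "K 0"]] by simp
  have "(\<lambda>n. energy M (\<lambda>x. u n x - g x)) \<longlonglongrightarrow> 0"
  proof (rule LIMSEQ_I)
    fix e :: real assume "0 < e"
    then obtain i where i: "(1/4::real)^i < e"
      using real_arch_pow_inv[of e "1/4"] by auto
    have "norm (energy M (\<lambda>x. u n x - g x) - 0) < e" if "n \<ge> K i" for n
    proof -
      have "ennreal (energy M (\<lambda>x. u n x - g x)) \<le> ennreal ((1/4)^i)"
        using bound[OF that] sq_integrable_norm_square[OF diff_sq[OF that]]
        by (simp add: nn_integral_eq_integral energy_def)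
      then have "energy M (\<lambda>x. u n x - g x) \<le> (1/4)^i"
        by simp
      then show ?thesis using i energy_nonneg[of M "\<lambda>x. u n x - g x"] by simp
    qed
    then show "\<exists>no. \<forall>n\<ge>no. norm (energy M (\<lambda>x. u n x - g x) - 0) < e" by blast
  qed
  with g_sq that show ?thesis by blast
qed

text \<open>The parallelogram law involves midpoints alone, so this replaces the convex hull and its
  coefficients; a property preserved by midpoints passes to the hull by rule induction.\<close>

inductive_set midpoint_hull :: "('a \<Rightarrow> 'b::real_vector) set \<Rightarrow> ('a \<Rightarrow> 'b) set"
  for X where
  base: "f \<in> X \<Longrightarrow> f \<in> midpoint_hull X"
| midpoint: "f \<in> midpoint_hull X \<Longrightarrow> g \<in> midpoint_hull X \<Longrightarrow>
    (\<lambda>x. (1/2) *\<^sub>R (f x + g x)) \<in> midpoint_hull X"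

lemma midpoint_hull_mono:
  assumes "X \<subseteq> Y" shows "midpoint_hull X \<subseteq> midpoint_hull Y"
proof
  fix f assume "f \<in> midpoint_hull X"
  then show "f \<in> midpoint_hull Y"
    by induction (use assms in \<open>auto intro: midpoint_hull.intros\<close>)
qed

lemma sq_integrable_midpoint_hull:
  assumes "f \<in> midpoint_hull X" "\<And>h. h \<in> X \<Longrightarrow> sq_integrable M h"
  shows "sq_integrable M f"
  using assms(1)
  by induction (auto intro: assms(2) intro!: sq_integrable_scaleR sq_integrable_add simp del: scaleR_add_right)

text \<open>Mazur's argument: energy-minimising elements of the midpoint hulls of the tails form a
  Cauchy sequence by the parallelogram law, and any functional that converges along the
  original sequence has the same limit along these elements.\<close>

lemma bounded_energy_weak_limit:
  fixes g :: "nat \<Rightarrow> 'a \<Rightarrow> 'b::euclidean_space"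
  assumes fin: "finite_measure M" and g: "\<And>n. sq_integrable M (g n)"
    and bound: "\<And>n. energy M (g n) \<le> C"
  obtains G where "sq_integrable M G"
    "\<And>\<psi> \<alpha>. sq_integrable M \<psi> \<Longrightarrow> (\<lambda>n. \<integral>x. g n x \<bullet> \<psi> x \<partial>M) \<longlonglongrightarrow> \<alpha> \<Longrightarrow> (\<integral>x. G x \<bullet> \<psi> x \<partial>M) = \<alpha>"
proof -
  define A where "A n = midpoint_hull (g ` {n..})" for n
  have A_mono: "A m \<subseteq> A n" if "n \<le> m" for m n
    unfolding A_def using that by (intro midpoint_hull_mono) auto
  have A_sq: "sq_integrable M f" if "f \<in> A n" for f n
    using that g unfolding A_def by (auto intro: sq_integrable_midpoint_hull)
  have gA: "g n \<in> A n" for n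
    unfolding A_def by (auto intro: midpoint_hull.base)
  \<comment> \<open>The hulls of the tails shrink, so their infimal energies increase; they stay
    below \<open>C\<close> because each \<open>g n\<close> lies in its own hull.\<close>
  define d where "d n = (INF f\<in>A n. energy M f)" for n
  have bdd: "bdd_below (energy M ` A n)" for n
    by (rule bdd_belowI[of _ 0]) (auto simp: energy_nonneg)
  have d_le: "d n \<le> energy M f" if "f \<in> A n" for f n
    unfolding d_def by (rule cINF_lower[OF bdd that])
  have d_mono: "d n \<le> d m" if "n \<le> m" for m n
    unfolding d_def using A_mono[OF that] gA by (intro cINF_superset_mono bdd) auto
  have d_bound: "d n \<le> C" for n
    using d_le[OF gA] bound order_trans by blast
  obtain D where D: "d \<longlonglongrightarrow> D" "\<And>n. d n \<le> D"
    using incseq_convergent[of d C] d_mono d_bound by (auto simp: incseq_def)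
  have "\<exists>f\<in>A n. energy M f < d n + 1 / real (Suc n)" for n
    using cINF_less_iff[of "A n" "energy M" "d n + 1 / real (Suc n)"] gA bdd
    by (auto simp: d_def[symmetric])
  then have "\<forall>n. \<exists>f. f \<in> A n \<and> energy M f < d n + 1 / real (Suc n)" by blast
  then obtain u where u: "\<And>n. u n \<in> A n" "\<And>n. energy M (u n) < d n + 1 / real (Suc n)"
    using choice by metis
  have u_sq: "sq_integrable M (u n)" for n
    using A_sq u by blast
  \<comment> \<open>The midpoint of \<open>u m\<close> and \<open>u n\<close> lies in
    \<open>A k\<close> and has energy at least \<open>d k\<close>, while both energies are at most
    \<open>D + 1 / real (Suc k)\<close>.\<close>
  have u_diff: "energy M (\<lambda>x. u m x - u n x) \<le> 4 / real (Suc k) + 4 * (D - d k)"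
    if "m \<ge> k" "n \<ge> k" for k m n
  proof -
    have "u m \<in> A k" "u n \<in> A k" using A_mono u that by blast+
    then have "(\<lambda>x. (1/2) *\<^sub>R (u m x + u n x)) \<in> A k"
      unfolding A_def by (rule midpoint_hull.midpoint)
    then have 1: "d k \<le> energy M (\<lambda>x. (1/2) *\<^sub>R (u m x + u n x))" by (rule d_le)
    have 2: "energy M (u j) \<le> D + 1 / real (Suc k)" if "j \<ge> k" for j
    proof -
      have "1 / real (Suc j) \<le> 1 / real (Suc k)" using that by (intro divide_left_mono) auto
      then show ?thesis using u(2)[of j] D(2)[of j] by linarith
    qed
    show ?thesis
      using energy_parallelogram[OF u_sq u_sq, of m n] 1 2[OF that(1)] 2[OF that(2)] by argo
  qed
  have "(\<lambda>k. 4 * (1 / real (Suc k)) + 4 * (D - d k)) \<longlonglongrightarrow> 4 * 0 + 4 * (D - D)"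
    by (intro tendsto_intros D(1) LIMSEQ_Suc[OF lim_1_over_n])
  then have small: "(\<lambda>k. 4 / real (Suc k) + 4 * (D - d k)) \<longlonglongrightarrow> 0" by simp
  obtain G where G: "sq_integrable M G" "(\<lambda>n. energy M (\<lambda>x. u n x - G x)) \<longlonglongrightarrow> 0"
  proof (rule sq_integrable_complete[OF fin u_sq])
    fix e :: real assume "0 < e"
    then obtain k where "4 / real (Suc k) + 4 * (D - d k) < e"
      using order_tendstoD(2)[OF small] by (auto simp: eventually_sequentially)
    then show "\<exists>k. \<forall>m\<ge>k. \<forall>n\<ge>k. energy M (\<lambda>x. u m x - u n x) \<le> e"
      using u_diff by (meson less_imp_le order_trans)
  qed
  \<comment> \<open>\<open>G\<close> is fixed before \<open>\<psi>\<close>; it is tested against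
    those \<open>\<psi>\<close> whose pairings already converge, so no weakly convergent subsequence
    has to be extracted here.\<close>
  have "(\<integral>x. G x \<bullet> \<psi> x \<partial>M) = \<alpha>"
    if \<psi>: "sq_integrable M \<psi>" and \<alpha>: "(\<lambda>n. \<integral>x. g n x \<bullet> \<psi> x \<partial>M) \<longlonglongrightarrow> \<alpha>" for \<psi> \<alpha>
  proof (rule LIMSEQ_unique)
    show "(\<lambda>n. \<integral>x. u n x \<bullet> \<psi> x \<partial>M) \<longlonglongrightarrow> (\<integral>x. G x \<bullet> \<psi> x \<partial>M)"
      by (rule inner_integral_tendsto[OF u_sq G(1) \<psi> G(2)])
    show "(\<lambda>n. \<integral>x. u n x \<bullet> \<psi> x \<partial>M) \<longlonglongrightarrow> \<alpha>"
    proof (rule LIMSEQ_I)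
      fix e :: real assume "0 < e"
      then obtain k where k: "\<And>n. n \<ge> k \<Longrightarrow> \<bar>(\<integral>x. g n x \<bullet> \<psi> x \<partial>M) - \<alpha>\<bar> < e"
        using LIMSEQ_D[OF \<alpha>] by (auto simp: real_norm_def)
      \<comment> \<open>An interval around \<open>\<alpha>\<close> is closed under midpoints, so the
        estimate passes from the tail to its hull.\<close>
      have hull: "\<bar>(\<integral>x. f x \<bullet> \<psi> x \<partial>M) - \<alpha>\<bar> < e" if "f \<in> A k" for f
        using that unfolding A_def
      proof induction
        case (base f)
        then show ?case using k by auto
      next
        case (midpoint f h)
        then have "f \<in> A k" "h \<in> A k" by (auto simp: A_def)
        then have "(\<integral>x. ((1/2) *\<^sub>R (f x + h x)) \<bullet> \<psi> x \<partial>M)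
            = ((\<integral>x. f x \<bullet> \<psi> x \<partial>M) + (\<integral>x. h x \<bullet> \<psi> x \<partial>M)) / 2"
          using sq_integrable_inner[OF A_sq \<psi>] by (simp add: inner_add_left)
        then show ?case using midpoint.IH by argo
      qed
      have "norm ((\<integral>x. u n x \<bullet> \<psi> x \<partial>M) - \<alpha>) < e" if "n \<ge> k" for n
        using hull A_mono[OF that] u(1) by (auto simp: real_norm_def)
      then show "\<exists>no. \<forall>n\<ge>no. norm ((\<integral>x. u n x \<bullet> \<psi> x \<partial>M) - \<alpha>) < e" by blast
    qed
  qed
  with G(1) that show ?thesis by blast
qed

section \<open>Weak derivatives on one period\<close>

abbreviation period_measure :: "real measure" where
  "period_measure \<equiv> restrict_space lborel {0..2*pi}"

lemma finite_period_measure: "finite_measure period_measure"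
  by (rule finite_measureI) (simp add: emeasure_restrict_space space_restrict_space)

lemma space_period_measure: "space period_measure = {0..2*pi}"
  by (simp add: space_restrict_space)

lemma measure_period_measure: "measure period_measure (space period_measure) = 2 * pi"
  by (simp add: space_period_measure measure_restrict_space)

lemma integrable_period_iff:
  fixes f :: "real \<Rightarrow> 'a::euclidean_space"
  shows "integrable period_measure f \<longleftrightarrow> set_integrable lborel {0..2*pi} f"
  by (simp add: integrable_restrict_space set_integrable_def)

lemma set_integral_period:
  fixes f :: "real \<Rightarrow> 'a::euclidean_space"
  shows "(LINT t:{0..2*pi}|lborel. f t) = (\<integral>t. f t \<partial>period_measure)"
  by (simp add: integral_restrict_space set_lebesgue_integral_def)

lemma set_integral_subinterval:
  fixes f :: "real \<Rightarrow> 'a::euclidean_space"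
  assumes "0 \<le> a" "b \<le> 2*pi"
  shows "(LINT t:{a..b}|lborel. f t) = (\<integral>t. indicator {a..b} t *\<^sub>R f t \<partial>period_measure)"
  using assms by (auto simp: integral_restrict_space set_lebesgue_integral_def
      intro!: Bochner_Integration.integral_cong split: split_indicator)

lemma borel_measurable_period_continuous:
  fixes f :: "real \<Rightarrow> 'a::euclidean_space"
  assumes "continuous_on {0..2*pi} f"
  shows "f \<in> borel_measurable period_measure"
proof -
  have "set_borel_measurable borel {0..2*pi} f"
    by (intro borel_measurable_continuous_on_indicator[folded set_borel_measurable_def] assms) auto
  then show ?thesis
    by (subst borel_measurable_restrict_space_iff) (auto simp: set_borel_measurable_def)
qed

lemma sq_integrable_bounded:
  assumes "finite_measure M" "f \<in> borel_measurable M" "\<And>x. x \<in> space M \<Longrightarrow> norm (f x) \<le> B"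
  shows "sq_integrable M f"
proof -
  interpret finite_measure M by fact
  have "integrable M (\<lambda>x. (norm (f x))\<^sup>2)"
  proof (rule integrable_const_bound[where B="B\<^sup>2"])
    show "AE x in M. norm ((norm (f x))\<^sup>2) \<le> B\<^sup>2"
      using assms(3) by (intro AE_I2) (simp add: power_mono)
  qed (use assms(2) in measurable)
  then show ?thesis using assms(2) by (simp add: sq_integrable_def)
qed

lemma energy_bounded:
  assumes "f \<in> borel_measurable period_measure" "\<And>t. t \<in> {0..2*pi} \<Longrightarrow> norm (f t) \<le> B"
  shows "energy period_measure f \<le> 2 * pi * B\<^sup>2"
proof -
  interpret finite_measure period_measure by (rule finite_period_measure)
  have "energy period_measure f \<le> (\<integral>t. B\<^sup>2 \<partial>period_measure)"
    unfolding energy_def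
    using sq_integrable_bounded[OF finite_period_measure assms(1)] assms(2)
    by (intro integral_mono sq_integrable_norm_square) (auto simp: space_period_measure power_mono)
  then show ?thesis using measure_period_measure by simp
qed

lemma sq_integrable_continuous:
  fixes f :: "real \<Rightarrow> 'a::euclidean_space"
  assumes "continuous_on {0..2*pi} f"
  shows "sq_integrable period_measure f"
proof -
  have "bounded (f ` {0..2*pi})"
    using assms by (intro compact_imp_bounded compact_continuous_image) auto
  then obtain B where "\<And>t. t \<in> {0..2*pi} \<Longrightarrow> norm (f t) \<le> B"
    unfolding bounded_iff by blast
  then show ?thesis
    using borel_measurable_period_continuous[OF assms]
    by (intro sq_integrable_bounded[OF finite_period_measure]) (auto simp: space_period_measure)
qed

text \<open>Closed intervals generate the Borel sets, and the sets over which the difference has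
  integral zero are stable under complements and disjoint unions; a function with vanishing integral
  over every Borel set is zero a.e.\<close>

lemma AE_eq_if_interval_integrals_eq:
  fixes f g :: "real \<Rightarrow> 'a::euclidean_space"
  assumes f: "integrable period_measure f" and g: "integrable period_measure g"
    and eq: "\<And>a b. 0 \<le> a \<Longrightarrow> a \<le> b \<Longrightarrow> b \<le> 2*pi \<Longrightarrow>
      (LINT t:{a..b}|lborel. f t) = (LINT t:{a..b}|lborel. g t)"
  shows "AE t in period_measure. f t = g t"
proof -
  \<comment> \<open>Extension by zero moves the problem to the whole line, where the complement step
    uses the total integral, here the one over a period.\<close>
  define d where "d t = indicator {0..2*pi} t *\<^sub>R f t - indicator {0..2*pi} t *\<^sub>R g t" for t
  have f': "integrable lborel (\<lambda>t. indicator {0..2*pi} t *\<^sub>R f t)"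
    and g': "integrable lborel (\<lambda>t. indicator {0..2*pi} t *\<^sub>R g t)"
    using f g by (simp_all add: integrable_restrict_space)
  have d_int: "integrable lborel d"
    unfolding d_def using f' g' by simp
  have d_set: "set_integrable lborel A d" if "A \<in> sets borel" for A
    using integrable_mult_indicator[OF _ d_int, of A] that by (simp add: set_integrable_def)
  have d_Icc: "(LINT t:{a..b}|lborel. d t) = 0" for a b
  proof (cases "max 0 a \<le> min (2*pi) b")
    case True
    let ?a = "max 0 a" and ?b = "min (2*pi) b"
    have "(LINT t:{a..b}|lborel. d t)
        = (\<integral>t. indicator {?a..?b} t *\<^sub>R f t - indicator {?a..?b} t *\<^sub>R g t \<partial>lborel)"
      unfolding set_lebesgue_integral_def d_def
      by (intro Bochner_Integration.integral_cong) (auto split: split_indicator)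
    also have "\<dots> = (LINT t:{?a..?b}|lborel. f t) - (LINT t:{?a..?b}|lborel. g t)"
      unfolding set_lebesgue_integral_def
    proof (rule Bochner_Integration.integral_diff)
      show "integrable lborel (\<lambda>t. indicator {?a..?b} t *\<^sub>R f t)"
        using integrable_mult_indicator[OF _ f', of "{?a..?b}"]
        by (rule Bochner_Integration.integrable_cong[THEN iffD1, rotated -1]) (auto split: split_indicator)
      show "integrable lborel (\<lambda>t. indicator {?a..?b} t *\<^sub>R g t)"
        using integrable_mult_indicator[OF _ g', of "{?a..?b}"]
        by (rule Bochner_Integration.integrable_cong[THEN iffD1, rotated -1]) (auto split: split_indicator)
    qed
    also have "\<dots> = 0" using eq[of ?a ?b] True by simp
    finally show ?thesis .
  next
    case False
    then have "t \<notin> {a..b} \<or> t \<notin> {0..2*pi}" for t by auto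
    then have z: "indicat_real {a..b} t *\<^sub>R d t = 0" for t
      unfolding d_def by (metis diff_zero indicator_simps(2) scaleR_zero_left scaleR_zero_right)
    show ?thesis unfolding set_lebesgue_integral_def z by simp
  qed
  have d_total: "(\<integral>t. d t \<partial>lborel) = 0"
  proof -
    have "(LINT t:{0..2*pi}|lborel. d t) = (\<integral>t. d t \<partial>lborel)"
      unfolding set_lebesgue_integral_def d_def
      by (intro Bochner_Integration.integral_cong) (auto split: split_indicator)
    then show ?thesis using d_Icc[of 0 "2*pi"] by simp
  qed
  have "(LINT t:A|lborel. d t) = 0" if "A \<in> sets borel" for A
    using that
  proof (induction rule: borel_set_induct)
    case empty
    then show ?case by (simp add: set_lebesgue_integral_def)
  next
    case (interval a b)
    show ?case by (rule d_Icc)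
  next
    case (compl A)
    have "(LINT t:A \<union> - A|lborel. d t) = (LINT t:A|lborel. d t) + (LINT t:- A|lborel. d t)"
      using compl by (intro set_integral_Un d_set) auto
    then show ?case using compl d_total by (simp add: set_lebesgue_integral_def)
  next
    case (union A)
    have "(LINT t:(\<Union>i. A i)|lborel. d t) = (\<Sum>i. (LINT t:A i|lborel. d t))"
      using union by (intro lebesgue_integral_countable_add d_set) (auto simp: disjoint_family_on_def)
    then show ?case using union by simp
  qed
  then have "AE t in lborel. d t = 0"
    by (intro sigma_finite_measure.density_zero[OF sigma_finite_lborel] d_int) auto
  then show ?thesis
    by (subst AE_restrict_space_iff) (auto simp: d_def elim: eventually_mono)
qed

text \<open>Cauchy-Schwarz against the indicator of the interval, whose energy is its length. The
  factor \<open>b - a\<close> is the source of the Hoelder and oscillation bounds below.\<close>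

lemma norm_set_integral_le:
  fixes h :: "real \<Rightarrow> 'a::euclidean_space"
  assumes h: "sq_integrable period_measure h" and ab: "0 \<le> a" "a \<le> b" "b \<le> 2*pi"
  shows "norm (LINT t:{a..b}|lborel. h t) \<le> sqrt ((b - a) * energy period_measure h)"
proof -
  let ?i = "indicat_real {a..b}"
  have ms: "{a..b} \<in> sets period_measure"
    using ab by (auto simp: sets_restrict_space_iff)
  have i: "sq_integrable period_measure ?i"
    using ms by (intro sq_integrable_bounded[OF finite_period_measure, where B=1]) (auto split: split_indicator)
  have "energy period_measure ?i = (\<integral>t. ?i t \<partial>period_measure)"
    unfolding energy_def by (intro Bochner_Integration.integral_cong) (auto split: split_indicator)
  also have "\<dots> = measure period_measure ({a..b} \<inter> space period_measure)"
    using ms by simp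
  also have "\<dots> = b - a"
    using ab by (simp add: measure_restrict_space space_restrict_space Int_absorb2)
  finally have e: "energy period_measure ?i = b - a" .
  have "norm (LINT t:{a..b}|lborel. h t) \<le> (\<integral>t. norm (?i t *\<^sub>R h t) \<partial>period_measure)"
    using ab by (simp only: set_integral_subinterval integral_norm_bound)
  also have "\<dots> = (\<integral>t. ?i t \<bullet> norm (h t) \<partial>period_measure)"
    by (intro Bochner_Integration.integral_cong) (auto split: split_indicator)
  also have "\<dots> \<le> sqrt ((b - a) * energy period_measure h)"
    using inner_integral_Cauchy_Schwarz[OF i sq_integrable_norm[OF h]]
    by (intro real_le_rsqrt) (simp add: e energy_norm)
  finally show ?thesis .
qed

section \<open>Weak derivatives: uniqueness, Hoelder continuity, sums and limits\<close>

lemma is_wderiv_sq_integrable: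
  assumes "is_wderiv f g" shows "sq_integrable period_measure g"
  using assms by (auto simp: is_wderiv_def sq_integrable_def integrable_period_iff measurable_restrict_space1)

lemma is_wderiv_integral:
  "is_wderiv f g \<Longrightarrow> a \<le> b \<Longrightarrow> f b - f a = (LINT t:{a..b}|lborel. g t)"
  by (simp add: is_wderiv_def)

lemma is_wderiv_AE_unique:
  assumes "is_wderiv f g" "is_wderiv f h"
  shows "AE t in period_measure. g t = h t"
  using assms
  by (intro AE_eq_if_interval_integrals_eq sq_integrable_integrable[OF finite_period_measure]
      is_wderiv_sq_integrable) (auto simp flip: is_wderiv_integral)

lemma H1_loop_wderiv: "H1_loop f \<Longrightarrow> is_wderiv f (wderiv f)"
  unfolding H1_loop_def wderiv_def by (auto intro: someI[of "is_wderiv f"])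

text \<open>\<open>wderiv\<close> comes from \<open>SOME\<close>, so a derivative found by
  computation is identified with it only almost everywhere; under integrals over a period that is
  enough.\<close>

lemma wderiv_AE_eq:
  assumes "is_wderiv f g"
  shows "AE t in period_measure. wderiv f t = g t"
  using is_wderiv_AE_unique[OF someI[of "is_wderiv f", OF assms] assms] by (simp add: wderiv_def)

lemma is_wderiv_Hoelder:
  assumes "is_wderiv f g" "s \<in> {0..2*pi}" "t \<in> {0..2*pi}"
  shows "norm (f s - f t) \<le> sqrt (\<bar>s - t\<bar> * energy period_measure g)"
proof (cases "s \<le> t")
  case True
  then show ?thesis
    using norm_set_integral_le[OF is_wderiv_sq_integrable[OF assms(1)], of s t]
      is_wderiv_integral[OF assms(1), of s t] assms(2,3) norm_minus_commute[of "f s" "f t"] by simp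
next
  case False
  then show ?thesis
    using norm_set_integral_le[OF is_wderiv_sq_integrable[OF assms(1)], of t s]
      is_wderiv_integral[OF assms(1), of t s] assms(2,3) by simp
qed

lemma is_wderiv_continuous_on:
  assumes "is_wderiv f g" shows "continuous_on {0..2*pi} f"
proof (rule continuous_onI)
  fix t e :: real assume t: "t \<in> {0..2*pi}" and "0 < e"
  define E where "E = energy period_measure g + 1"
  have "E > 0" using energy_nonneg[of period_measure g] by (simp add: E_def)
  have "dist (f s) (f t) \<le> e" if s: "s \<in> {0..2*pi}" "dist s t < e\<^sup>2 / E" for s
  proof -
    have "\<bar>s - t\<bar> * energy period_measure g \<le> \<bar>s - t\<bar> * E"
      by (intro mult_left_mono) (auto simp: E_def)
    also have "\<dots> \<le> e\<^sup>2"
      using s(2) \<open>E > 0\<close> by (simp add: dist_real_def field_simps)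
    finally have "sqrt (\<bar>s - t\<bar> * energy period_measure g) \<le> e"
      using \<open>0 < e\<close> real_sqrt_le_mono by fastforce
    then show ?thesis
      using is_wderiv_Hoelder[OF assms s(1) t] by (simp add: dist_norm)
  qed
  then show "\<exists>d>0. \<forall>s\<in>{0..2*pi}. dist s t < d \<longrightarrow> dist (f s) (f t) \<le> e"
    using \<open>0 < e\<close> \<open>E > 0\<close> by (intro exI[of _ "e\<^sup>2 / E"]) auto
qed

lemma is_wderiv_add:
  assumes "is_wderiv f f'" "is_wderiv g g'"
  shows "is_wderiv (\<lambda>t. f t + g t) (\<lambda>t. f' t + g' t)"
proof -
  have "sq_integrable period_measure (\<lambda>t. f' t + g' t)"
    by (intro sq_integrable_add is_wderiv_sq_integrable[OF assms(1)] is_wderiv_sq_integrable[OF assms(2)])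
  moreover have "f b + g b - (f a + g a) = (LINT t:{a..b}|lborel. f' t + g' t)" if "a \<le> b" for a b
  proof -
    have "(LINT t:{a..b}|lborel. f' t + g' t) = (LINT t:{a..b}|lborel. f' t) + (LINT t:{a..b}|lborel. g' t)"
      using assms by (intro set_integral_add(2)) (auto simp: is_wderiv_def)
    then show ?thesis
      using is_wderiv_integral[OF assms(1) that] is_wderiv_integral[OF assms(2) that]
      by (simp add: algebra_simps)
  qed
  ultimately show ?thesis
    using assms by (auto simp: is_wderiv_def sq_integrable_def integrable_period_iff intro!: set_integral_add(1))
qed

lemma is_wderiv_C1:
  fixes f :: "real \<Rightarrow> 'a::euclidean_space"
  assumes f: "\<And>t. (f has_vector_derivative f' t) (at t)" and f': "continuous_on UNIV f'"
  shows "is_wderiv f f'"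
  unfolding is_wderiv_def
proof (intro conjI allI impI)
  show "f' \<in> borel_measurable lborel"
    using borel_measurable_continuous_onI[OF f'] by simp
  show "set_integrable lborel {a..b} f'" for a b
    using f' continuous_on_subset by (intro borel_integrable_atLeastAtMost') blast
  show "set_integrable lborel {0..2*pi} (\<lambda>t. (norm (f' t))\<^sup>2)"
    using continuous_on_subset[OF f'] by (intro borel_integrable_atLeastAtMost' continuous_intros) auto
  show "f b - f a = (LINT t:{a..b}|lborel. f' t)" if "a \<le> b" for a b
    unfolding set_lebesgue_integral_def
    using f continuous_on_subset[OF f'] that
    by (intro integral_FTC_Icc[symmetric]) (auto intro: has_vector_derivative_at_within)
qed

text \<open>Testing against indicators of intervals shows that the integrals of any weak limit of
  the derivatives are the increments of \<open>F\<close>, which determines it a.e. Since every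
  subsequence leads to the same limit, the whole sequence converges weakly.\<close>

lemma weak_derivative_limit:
  fixes f g :: "nat \<Rightarrow> real \<Rightarrow> 'a::euclidean_space"
  assumes fg: "\<And>n. is_wderiv (f n) (g n)" and bound: "\<And>n. energy period_measure (g n) \<le> C"
    and lim: "\<And>t. t \<in> {0..2*pi} \<Longrightarrow> (\<lambda>n. f n t) \<longlonglongrightarrow> F t"
  obtains G where "sq_integrable period_measure G"
    "\<And>a b. 0 \<le> a \<Longrightarrow> a \<le> b \<Longrightarrow> b \<le> 2*pi \<Longrightarrow> F b - F a = (LINT t:{a..b}|lborel. G t)"
    "\<And>\<psi>. sq_integrable period_measure \<psi> \<Longrightarrow>
      (\<lambda>n. \<integral>t. g n t \<bullet> \<psi> t \<partial>period_measure) \<longlonglongrightarrow> (\<integral>t. G t \<bullet> \<psi> t \<partial>period_measure)"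
proof -
  \<comment> \<open>Stated for subsequences, so that a subsequence violating the claimed convergence
    also has such a limit.\<close>
  have sub: "\<exists>G. sq_integrable period_measure G \<and>
      (\<forall>a b. 0 \<le> a \<longrightarrow> a \<le> b \<longrightarrow> b \<le> 2*pi \<longrightarrow> F b - F a = (LINT t:{a..b}|lborel. G t)) \<and>
      (\<forall>\<psi> \<alpha>. sq_integrable period_measure \<psi> \<longrightarrow>
        (\<lambda>n. \<integral>t. g (r n) t \<bullet> \<psi> t \<partial>period_measure) \<longlonglongrightarrow> \<alpha> \<longrightarrow> (\<integral>t. G t \<bullet> \<psi> t \<partial>period_measure) = \<alpha>)"
    if r: "strict_mono r" for r :: "nat \<Rightarrow> nat"
  proof -
    obtain G where G: "sq_integrable period_measure G"
      "\<And>\<psi> \<alpha>. sq_integrable period_measure \<psi> \<Longrightarrow>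
        (\<lambda>n. \<integral>t. g (r n) t \<bullet> \<psi> t \<partial>period_measure) \<longlonglongrightarrow> \<alpha> \<Longrightarrow> (\<integral>t. G t \<bullet> \<psi> t \<partial>period_measure) = \<alpha>"
      using bounded_energy_weak_limit[OF finite_period_measure, of "\<lambda>n. g (r n)" C]
        is_wderiv_sq_integrable[OF fg] bound by blast
    have "F b - F a = (LINT t:{a..b}|lborel. G t)" if ab: "0 \<le> a" "a \<le> b" "b \<le> 2*pi" for a b
    proof (rule euclidean_eqI)
      fix e :: 'a assume "e \<in> Basis"
      \<comment> \<open>Pairing with this function gives one coordinate of the integral over
        \<open>{a..b}\<close>.\<close>
      let ?\<psi> = "\<lambda>t. indicator {a..b} t *\<^sub>R e"
      have ms: "{a..b} \<in> sets period_measure"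
        using ab by (auto simp: sets_restrict_space_iff)
      have \<psi>: "sq_integrable period_measure ?\<psi>"
        using ms by (intro sq_integrable_bounded[OF finite_period_measure, where B="norm e"]) (auto split: split_indicator)
      have *: "(\<integral>t. u t \<bullet> ?\<psi> t \<partial>period_measure) = (LINT t:{a..b}|lborel. u t) \<bullet> e"
        if u: "sq_integrable period_measure u" for u
      proof -
        have "integrable period_measure (\<lambda>t. indicator {a..b} t *\<^sub>R u t)"
          by (intro integrable_mult_indicator ms sq_integrable_integrable[OF finite_period_measure u])
        then show ?thesis
          using ab by (simp add: set_integral_subinterval flip: integral_inner_left)
      qed
      have "(\<lambda>n. (f (r n) b - f (r n) a) \<bullet> e) \<longlonglongrightarrow> (F b - F a) \<bullet> e"
        using ab LIMSEQ_subseq_LIMSEQ[OF lim r] by (intro tendsto_intros) (auto simp: o_def)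
      then have "(\<lambda>n. \<integral>t. g (r n) t \<bullet> ?\<psi> t \<partial>period_measure) \<longlonglongrightarrow> (F b - F a) \<bullet> e"
        by (simp only: *[OF is_wderiv_sq_integrable[OF fg]] is_wderiv_integral[OF fg ab(2)])
      then show "(F b - F a) \<bullet> e = (LINT t:{a..b}|lborel. G t) \<bullet> e"
        using G(2)[OF \<psi>] *[OF G(1)] by simp
    qed
    then show ?thesis using G by blast
  qed
  obtain G where G: "sq_integrable period_measure G"
    "\<And>a b. 0 \<le> a \<Longrightarrow> a \<le> b \<Longrightarrow> b \<le> 2*pi \<Longrightarrow> F b - F a = (LINT t:{a..b}|lborel. G t)"
    using sub[OF strict_mono_id] by blast
  have "(\<lambda>n. \<integral>t. g n t \<bullet> \<psi> t \<partial>period_measure) \<longlonglongrightarrow> (\<integral>t. G t \<bullet> \<psi> t \<partial>period_measure)"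
    if \<psi>: "sq_integrable period_measure \<psi>" for \<psi>
  proof (rule ccontr)
    let ?I = "\<lambda>n. \<integral>t. g n t \<bullet> \<psi> t \<partial>period_measure"
    let ?L = "\<integral>t. G t \<bullet> \<psi> t \<partial>period_measure"
    assume "\<not> ?I \<longlonglongrightarrow> ?L"
    then obtain e where e: "e > 0" "\<And>k. \<exists>n\<ge>k. \<bar>?I n - ?L\<bar> \<ge> e"
      unfolding LIMSEQ_iff real_norm_def by (meson not_le)
    \<comment> \<open>The pairings that stay \<open>e\<close> away from the limit are bounded, so
      some of them converge to an \<open>\<alpha>\<close>; the weak limit \<open>G'\<close> along
      those agrees with \<open>G\<close> a.e., which contradicts the gap.\<close>
    have "infinite {n. \<bar>?I n - ?L\<bar> \<ge> e}"
      using e(2) by (auto simp: infinite_nat_iff_unbounded_le)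
    then obtain r :: "nat \<Rightarrow> nat" where r: "strict_mono r" "\<And>n. \<bar>?I (r n) - ?L\<bar> \<ge> e"
      using infinite_enumerate[of "{n. \<bar>?I n - ?L\<bar> \<ge> e}"] by blast
    have "\<bar>?I n\<bar> \<le> sqrt (C * energy period_measure \<psi>)" for n
    proof (rule real_le_rsqrt)
      have "?I n ^ 2 \<le> energy period_measure (g n) * energy period_measure \<psi>"
        by (rule inner_integral_Cauchy_Schwarz[OF is_wderiv_sq_integrable[OF fg] \<psi>])
      also have "\<dots> \<le> C * energy period_measure \<psi>"
        by (intro mult_right_mono bound energy_nonneg)
      finally show "\<bar>?I n\<bar>\<^sup>2 \<le> C * energy period_measure \<psi>" by simp
    qed
    then have "bounded (range (\<lambda>n. ?I (r n)))"
      by (auto simp: bounded_iff)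
    then obtain \<alpha> s where s: "strict_mono (s :: nat \<Rightarrow> nat)" "(\<lambda>n. ?I (r (s n))) \<longlonglongrightarrow> \<alpha>"
      using bounded_imp_convergent_subsequence[of "\<lambda>n. ?I (r n)"] by (auto simp: o_def)
    obtain G' where G': "sq_integrable period_measure G'"
      "\<And>a b. 0 \<le> a \<Longrightarrow> a \<le> b \<Longrightarrow> b \<le> 2*pi \<Longrightarrow> F b - F a = (LINT t:{a..b}|lborel. G' t)"
      "(\<integral>t. G' t \<bullet> \<psi> t \<partial>period_measure) = \<alpha>"
      using sub[OF strict_mono_o[OF r(1) s(1)]] s(2) \<psi> by (auto simp: o_def)
    have "AE t in period_measure. G' t = G t"
      using G(2) G'(2)
      by (intro AE_eq_if_interval_integrals_eq sq_integrable_integrable[OF finite_period_measure] G(1) G'(1)) auto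
    then have "(\<integral>t. G' t \<bullet> \<psi> t \<partial>period_measure) = ?L"
      using G(1) G'(1) \<psi>
      by (intro integral_cong_AE) (auto dest!: sq_integrable_measurable elim: eventually_mono)
    then have "(\<lambda>n. \<bar>?I (r (s n)) - ?L\<bar>) \<longlonglongrightarrow> 0"
      using tendsto_rabs[OF LIM_zero[OF s(2)]] G'(3) by simp
    then have "e \<le> 0"
      using r(2) by (intro LIMSEQ_le_const) auto
    then show False using e(1) by simp
  qed
  with G that show ?thesis by blast
qed

section \<open>Extension of a weak derivative from one period to the line\<close>

lemma periodic_shift_int:
  fixes f :: "real \<Rightarrow> 'a"
  assumes per: "\<And>t. f (t + 2*pi) = f t"
  shows "f (t + 2*pi * of_int k) = f t"
proof -
  have nat: "f (t + 2*pi * real n) = f t" for n t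
  proof (induction n)
    case (Suc n)
    then show ?case using per[of "t + 2*pi * real n"] by (simp add: algebra_simps)
  qed simp
  show ?thesis
  proof (cases k)
    case (nonneg n)
    then show ?thesis using nat by simp
  next
    case (neg n)
    then have "real_of_int k + real (Suc n) = 0" by simp
    then have "2*pi * (real_of_int k + real (Suc n)) = 0" by simp
    then have "t + 2*pi * of_int k + 2*pi * real (Suc n) = t" by (simp only: distrib_left)
    then show ?thesis using nat[of "t + 2*pi * of_int k" "Suc n"] by metis
  qed
qed

lemma floor_period:
  "2*pi * of_int \<lfloor>t / (2*pi)\<rfloor> \<le> t" "t < 2*pi * (of_int \<lfloor>t / (2*pi)\<rfloor> + 1)"
proof -
  have "of_int \<lfloor>t / (2*pi)\<rfloor> \<le> t / (2*pi)" "t / (2*pi) < of_int \<lfloor>t / (2*pi)\<rfloor> + 1" by linarith+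
  then have "of_int \<lfloor>t / (2*pi)\<rfloor> * (2*pi) \<le> t" "t < (of_int \<lfloor>t / (2*pi)\<rfloor> + 1) * (2*pi)"
    by (simp_all only: pos_le_divide_eq pos_divide_less_eq zero_less_mult_iff zero_less_numeral pi_gt_zero simp_thms)
  then show "2*pi * of_int \<lfloor>t / (2*pi)\<rfloor> \<le> t" "t < 2*pi * (of_int \<lfloor>t / (2*pi)\<rfloor> + 1)"
    by (simp_all only: mult.commute)
qed

lemma period_representative:
  obtains s and k :: int where "s \<in> {0..2*pi}" "t = s + 2*pi * of_int k"
proof
  show "t - 2*pi * of_int \<lfloor>t / (2*pi)\<rfloor> \<in> {0..2*pi}"
    using floor_period[of t] unfolding distrib_left by auto
qed simp

text \<open>\<open>is_wderiv\<close> asks for the increment formula between any two reals, whereas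
  weak limits live on one period. Translates of \<open>G\<close> are glued; the formula holds inside
  each cell by periodicity of \<open>F\<close> and adds up across cells.\<close>

lemma is_wderiv_periodic_extension:
  fixes F G :: "real \<Rightarrow> 'a::euclidean_space"
  assumes per: "\<And>t. F (t + 2*pi) = F t" and G: "sq_integrable period_measure G"
    and FG: "\<And>a b. 0 \<le> a \<Longrightarrow> a \<le> b \<Longrightarrow> b \<le> 2*pi \<Longrightarrow> F b - F a = (LINT t:{a..b}|lborel. G t)"
  obtains g where "is_wderiv F g" "AE t in period_measure. g t = G t"
proof -
  \<comment> \<open>The inner indicator gives measurability on the line; the outer one removes the
    right endpoint so that the translates tile without overlap.\<close>
  define G0 where "G0 t = indicator {0..<2*pi} t *\<^sub>R (indicator {0..2*pi} t *\<^sub>R G t)" for t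
  have G_meas: "(\<lambda>t. indicator {0..2*pi} t *\<^sub>R G t) \<in> borel_measurable borel"
    using sq_integrable_measurable[OF G] by (subst (asm) borel_measurable_restrict_space_iff) auto
  have [measurable]: "G0 \<in> borel_measurable borel"
    unfolding G0_def by (rule borel_measurable_scaleR[OF _ G_meas]) simp
  define g where "g t = G0 (t - 2*pi * of_int \<lfloor>t / (2*pi)\<rfloor>)" for t
  have g_meas: "g \<in> borel_measurable borel"
    unfolding g_def by measurable
  have g_eq: "g t = G (t - 2*pi * of_int k)" if "2*pi * of_int k \<le> t" "t < 2*pi * (of_int k + 1)" for t k
  proof -
    have "\<lfloor>t / (2*pi)\<rfloor> = k" using that by (simp add: floor_eq_iff field_simps)
    moreover have "t - 2*pi * of_int k \<in> {0..<2*pi}" using that by (simp add: algebra_simps)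
    ultimately show ?thesis by (simp add: g_def G0_def)
  qed
  define P where "P a b \<longleftrightarrow> set_integrable lborel {a..b} g \<and> F b - F a = (LINT t:{a..b}|lborel. g t)" for a b
  \<comment> \<open>Inside one cell, translation by \<open>2*pi * of_int k\<close> reduces to the
    hypothesis; the right endpoint, where \<open>g\<close> already belongs to the next cell, is a
    null set.\<close>
  have P_cell: "P a b" if ab: "2*pi * of_int k \<le> a" "a \<le> b" "b \<le> 2*pi * (of_int k + 1)" for a b k
  proof -
    let ?s = "2*pi * of_int k"
    define J where "J t = indicator {a - ?s..b - ?s} t *\<^sub>R G t" for t
    have ms: "{a - ?s..b - ?s} \<in> sets period_measure"
      using ab by (auto simp: sets_restrict_space_iff algebra_simps)
    have "integrable period_measure J"
      unfolding J_def by (intro integrable_mult_indicator ms sq_integrable_integrable[OF finite_period_measure G])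
    then have "integrable lborel (\<lambda>t. indicator {0..2*pi} t *\<^sub>R J t)"
      by (simp add: integrable_restrict_space)
    moreover have "(\<lambda>t. indicator {0..2*pi} t *\<^sub>R J t) = J"
      using ab by (auto simp: J_def fun_eq_iff algebra_simps split: split_indicator)
    ultimately have J: "integrable lborel J" by simp
    have shift: "integrable lborel (\<lambda>t. J (- ?s + 1 * t))"
      using J by (subst lborel_integrable_real_affine_iff) auto
    have "AE t in lborel. t \<noteq> 2*pi * (of_int k + 1)" by (rule AE_lborel_singleton)
    then have ae: "AE t in lborel. indicator {a..b} t *\<^sub>R g t = J (- ?s + 1 * t)"
    proof eventually_elim
      case (elim t)
      show ?case
      proof (cases "t \<in> {a..b}")
        case True
        then show ?thesis using elim ab g_eq[of k t] by (simp add: J_def)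
      qed (auto simp: J_def split: split_indicator)
    qed
    have meas: "(\<lambda>t. indicator {a..b} t *\<^sub>R g t) \<in> borel_measurable lborel"
      using g_meas by simp
    have 1: "set_integrable lborel {a..b} g"
      unfolding set_integrable_def
      using integrable_cong_AE[OF meas borel_measurable_integrable[OF shift] ae] shift by simp
    have "(LINT t:{a..b}|lborel. g t) = (\<integral>t. J (- ?s + 1 * t) \<partial>lborel)"
      unfolding set_lebesgue_integral_def
      by (rule integral_cong_AE[OF meas borel_measurable_integrable[OF shift] ae])
    also have "\<dots> = (\<integral>t. J t \<partial>lborel)"
      using lborel_integral_real_affine[of 1 J "- ?s"] by simp
    also have "\<dots> = (LINT t:{a - ?s..b - ?s}|lborel. G t)"
      by (simp add: J_def set_lebesgue_integral_def)
    also have "\<dots> = F (b - ?s) - F (a - ?s)"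
      using FG[of "a - ?s" "b - ?s"] ab by (simp add: algebra_simps)
    also have "\<dots> = F b - F a"
      using periodic_shift_int[of F a "- k", OF per] periodic_shift_int[of F b "- k", OF per] by simp
    finally show ?thesis using 1 by (simp add: P_def)
  qed
  have P_trans: "P a c" if "P a b" "P b c" "a \<le> b" "b \<le> c" for a b c
  proof -
    have Un: "{a..c} = {a..b} \<union> {b..c}" using that by auto
    have i: "set_integrable lborel {a..b} g" "set_integrable lborel {b..c} g"
      using that by (auto simp: P_def)
    have "AE t in lborel. t \<noteq> b" by (rule AE_lborel_singleton)
    then have "AE t in lborel. \<not> (t \<in> {a..b} \<and> t \<in> {b..c})"
      by eventually_elim auto
    then have "(LINT t:{a..c}|lborel. g t) = (LINT t:{a..b}|lborel. g t) + (LINT t:{b..c}|lborel. g t)"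
      unfolding Un by (intro set_integral_Un_AE i) auto
    moreover have "set_integrable lborel {a..c} g"
      unfolding Un by (intro set_integrable_Un i) auto
    ultimately show ?thesis using that by (simp add: P_def algebra_simps)
  qed
  \<comment> \<open>Here \<open>n\<close> counts the cells beyond that of \<open>a\<close> which
    \<open>b\<close> may reach.\<close>
  have P_upto: "b \<le> 2*pi * (of_int \<lfloor>a / (2*pi)\<rfloor> + 1 + real n) \<Longrightarrow> a \<le> b \<Longrightarrow> P a b" for a b n
  proof (induction n arbitrary: b)
    case 0
    then show ?case using floor_period(1)[of a] by (intro P_cell) auto
  next
    case (Suc n)
    let ?c = "2*pi * (of_int \<lfloor>a / (2*pi)\<rfloor> + 1 + real n)"
    show ?case
    proof (cases "b \<le> ?c")
      case True
      then show ?thesis using Suc by blast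
    next
      case False
      have "2*pi * (of_int \<lfloor>a / (2*pi)\<rfloor> + 1) \<le> ?c" by (intro mult_left_mono) auto
      then have ac: "a \<le> ?c" using floor_period(2)[of a] by linarith
      then have "P a ?c" using Suc.IH by blast
      moreover have "P ?c b"
        using False Suc.prems
        by (intro P_cell[of "\<lfloor>a / (2*pi)\<rfloor> + 1 + int n"]) (auto simp: algebra_simps)
      ultimately show ?thesis using ac False by (auto intro: P_trans)
    qed
  qed
  have P_all: "P a b" if "a \<le> b" for a b
  proof -
    obtain n where "b / (2*pi) - of_int \<lfloor>a / (2*pi)\<rfloor> - 1 \<le> real n"
      using real_arch_simple by blast
    then have "2*pi * (b / (2*pi)) \<le> 2*pi * (of_int \<lfloor>a / (2*pi)\<rfloor> + 1 + real n)"
      by (intro mult_left_mono) auto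
    then have "b \<le> 2*pi * (of_int \<lfloor>a / (2*pi)\<rfloor> + 1 + real n)" by simp
    then show ?thesis using P_upto that by blast
  qed
  have "AE t in lborel. t \<noteq> 2*pi" by (rule AE_lborel_singleton)
  then have ae: "AE t in period_measure. g t = G t"
    by (subst AE_restrict_space_iff) (auto elim!: eventually_mono intro: g_eq[of 0, simplified])
  have "integrable period_measure (\<lambda>t. (norm (g t))\<^sup>2) \<longleftrightarrow> integrable period_measure (\<lambda>t. (norm (G t))\<^sup>2)"
    using ae sq_integrable_measurable[OF G] measurable_restrict_space1[of g lborel borel "{0..2*pi}"] g_meas
    by (intro integrable_cong_AE) (auto elim: eventually_mono)
  then have "set_integrable lborel {0..2*pi} (\<lambda>t. (norm (g t))\<^sup>2)"
    using sq_integrable_norm_square[OF G] by (simp add: integrable_period_iff)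
  moreover have "set_integrable lborel {a..b} g" for a b
    using P_all[of a b] by (cases "a \<le> b") (auto simp: P_def set_integrable_def)
  ultimately have "is_wderiv F g"
    using g_meas P_all by (auto simp: is_wderiv_def P_def)
  with ae that show ?thesis by blast
qed

lemma inner_integral_AE_cong:
  assumes "sq_integrable M f" "sq_integrable M g" "sq_integrable M \<psi>" "AE x in M. f x = g x"
  shows "(\<integral>x. f x \<bullet> \<psi> x \<partial>M) = (\<integral>x. g x \<bullet> \<psi> x \<partial>M)"
  using assms
  by (intro integral_cong_AE) (auto dest!: sq_integrable_measurable elim: eventually_mono)

lemma H1_loop_limit:
  fixes f :: "nat \<Rightarrow> real \<Rightarrow> 'a::euclidean_space"
  assumes f: "\<And>n. H1_loop (f n)" and bound: "\<And>n. energy period_measure (wderiv (f n)) \<le> C"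
    and lim: "\<And>t. (\<lambda>n. f n t) \<longlonglongrightarrow> F t"
  shows "H1_loop F"
    and "sq_integrable period_measure \<psi> \<Longrightarrow>
      (\<lambda>n. \<integral>t. wderiv (f n) t \<bullet> \<psi> t \<partial>period_measure) \<longlonglongrightarrow> (\<integral>t. wderiv F t \<bullet> \<psi> t \<partial>period_measure)"
proof -
  obtain G where G: "sq_integrable period_measure G"
    "\<And>a b. 0 \<le> a \<Longrightarrow> a \<le> b \<Longrightarrow> b \<le> 2*pi \<Longrightarrow> F b - F a = (LINT t:{a..b}|lborel. G t)"
    "\<And>\<psi>. sq_integrable period_measure \<psi> \<Longrightarrow>
      (\<lambda>n. \<integral>t. wderiv (f n) t \<bullet> \<psi> t \<partial>period_measure) \<longlonglongrightarrow> (\<integral>t. G t \<bullet> \<psi> t \<partial>period_measure)"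
    using weak_derivative_limit[of f "\<lambda>n. wderiv (f n)" C F] H1_loop_wderiv[OF f] bound lim by blast
  have per: "F (t + 2*pi) = F t" for t
  proof (rule LIMSEQ_unique[OF lim])
    have "f n (t + 2*pi) = f n t" for n
      using f by (simp add: H1_loop_def)
    then show "(\<lambda>n. f n (t + 2*pi)) \<longlonglongrightarrow> F t"
      using lim[of t] by simp
  qed
  obtain g where g: "is_wderiv F g" "AE t in period_measure. g t = G t"
    using is_wderiv_periodic_extension[of F G, OF per G(1) G(2)] by blast
  then show F: "H1_loop F" using per by (auto simp: H1_loop_def)
  show "(\<lambda>n. \<integral>t. wderiv (f n) t \<bullet> \<psi> t \<partial>period_measure) \<longlonglongrightarrow> (\<integral>t. wderiv F t \<bullet> \<psi> t \<partial>period_measure)"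
    if "sq_integrable period_measure \<psi>"
  proof -
    have "AE t in period_measure. wderiv F t = G t"
      using wderiv_AE_eq[OF g(1)] g(2) by eventually_elim simp
    then have "(\<integral>t. wderiv F t \<bullet> \<psi> t \<partial>period_measure) = (\<integral>t. G t \<bullet> \<psi> t \<partial>period_measure)"
      by (intro inner_integral_AE_cong is_wderiv_sq_integrable[OF H1_loop_wderiv[OF F]] G(1) that)
    then show ?thesis using G(3)[OF that] by simp
  qed
qed

lemma sq_integrable_bounded_linear:
  assumes L: "bounded_linear L" and g: "sq_integrable M g"
  shows "sq_integrable M (\<lambda>x. L (g x))"
proof -
  interpret bounded_linear L by fact
  obtain K where K: "\<And>x. norm (L x) \<le> norm x * K" "K > 0" using pos_bounded by blast
  have m: "(\<lambda>x. L (g x)) \<in> borel_measurable M"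
    using borel_measurable_continuous_on[OF linear_continuous_on[OF L] sq_integrable_measurable[OF g]] .
  have "integrable M (\<lambda>x. (norm (L (g x)))\<^sup>2)"
  proof (rule Bochner_Integration.integrable_bound)
    show "integrable M (\<lambda>x. K\<^sup>2 * (norm (g x))\<^sup>2)"
      using sq_integrable_norm_square[OF g] by simp
    have "(norm (L (g x)))\<^sup>2 \<le> K\<^sup>2 * (norm (g x))\<^sup>2" for x
      using power_mono[OF K(1)[of "g x"] norm_ge_zero, of 2] by (simp add: power_mult_distrib mult.commute)
    then show "AE x in M. norm ((norm (L (g x)))\<^sup>2) \<le> norm (K\<^sup>2 * (norm (g x))\<^sup>2)"
      by simp
  qed (use m in measurable)
  with m show ?thesis by (simp add: sq_integrable_def)
qed

lemma is_wderiv_bounded_linear: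
  assumes L: "bounded_linear L" and fg: "is_wderiv f g"
  shows "is_wderiv (\<lambda>t. L (f t)) (\<lambda>t. L (g t))"
proof -
  interpret bounded_linear L by fact
  have int: "set_integrable lborel {a..b} g" for a b using fg by (simp add: is_wderiv_def)
  have "(\<lambda>t. L (g t)) \<in> borel_measurable lborel"
    using fg by (intro borel_measurable_continuous_on[OF linear_continuous_on[OF L]]) (simp add: is_wderiv_def)
  moreover have "set_integrable lborel {a..b} (\<lambda>t. L (g t))" for a b
    using integrable_bounded_linear[OF L, of lborel "\<lambda>t. indicator {a..b} t *\<^sub>R g t"] int[of a b]
    by (simp add: set_integrable_def scaleR)
  moreover have "L (f b) - L (f a) = (LINT t:{a..b}|lborel. L (g t))" if "a \<le> b" for a b
    using integral_bounded_linear[OF L, of lborel "\<lambda>t. indicator {a..b} t *\<^sub>R g t"] int[of a b]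
      is_wderiv_integral[OF fg that]
    by (simp add: set_integrable_def set_lebesgue_integral_def scaleR flip: diff)
  moreover have "set_integrable lborel {0..2*pi} (\<lambda>t. (norm (L (g t)))\<^sup>2)"
    using sq_integrable_bounded_linear[OF L is_wderiv_sq_integrable[OF fg]]
    by (simp add: sq_integrable_def integrable_period_iff)
  ultimately show ?thesis unfolding is_wderiv_def by blast
qed

section \<open>Coercivity\<close>

text \<open>With \<open>h = g + \<i>\<omega>\<zeta>\<close> and \<open>H t = \<integral>\<^sub>0\<^sup>t h\<close>, the function \<open>v = \<zeta> - H\<close> is continuously differentiable
  even though \<open>\<zeta>\<close> is not, and \<open>exp (\<i>\<omega>t) v\<close> has the derivative \<open>- \<i>\<omega> exp (\<i>\<omega>t) H\<close>.\<close>

lemma rotating_frame_bounds: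
  fixes \<zeta> g :: "real \<Rightarrow> complex"
  assumes \<zeta>: "is_wderiv \<zeta> g" and \<omega>: "0 \<le> \<omega>"
    and \<eta>: "\<eta> = sqrt (2*pi * energy period_measure (\<lambda>t. g t + \<i> * complex_of_real \<omega> * \<zeta> t))"
  shows "t \<in> {0..2*pi} \<Longrightarrow> cmod (\<zeta> t) \<le> cmod (\<zeta> 0) + (1 + 2*pi*\<omega>) * \<eta>"
    and "\<zeta> (2*pi) = \<zeta> 0 \<Longrightarrow> cmod (exp (\<i> * complex_of_real (2*pi*\<omega>)) - 1) * cmod (\<zeta> 0) \<le> (1 + 2*pi*\<omega>) * \<eta>"
proof -
  define h where "h t = g t + \<i> * complex_of_real \<omega> * \<zeta> t" for t
  define Z where "Z t = integral {0..t} \<zeta>" for t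
  define v where "v t = \<zeta> 0 - \<i> * complex_of_real \<omega> * Z t" for t
  define E where "E t = exp (complex_of_real t * (\<i> * complex_of_real \<omega>)) * v t" for t
  have cont: "continuous_on {0..2*pi} \<zeta>" by (rule is_wderiv_continuous_on[OF \<zeta>])
  have h: "sq_integrable period_measure h"
  proof -
    have "sq_integrable period_measure (\<lambda>t. \<i> * complex_of_real \<omega> * \<zeta> t)"
      by (intro sq_integrable_continuous continuous_intros cont)
    then show ?thesis unfolding h_def
      by (intro sq_integrable_add is_wderiv_sq_integrable[OF \<zeta>])
  qed
  have \<eta>_nonneg: "0 \<le> \<eta>" unfolding \<eta> by (simp add: energy_nonneg)
  \<comment> \<open>\<open>\<zeta> - v\<close> is the primitive of \<open>h\<close> starting at 0,
    which Cauchy-Schwarz bounds by \<open>\<eta>\<close> over a period.\<close>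
  have diff: "cmod (\<zeta> t - v t) \<le> \<eta>" if t: "t \<in> {0..2*pi}" for t
  proof -
    have c: "continuous_on {0..t} \<zeta>" using cont t by (auto intro: continuous_on_subset)
    then have i: "set_integrable lborel {0..t} \<zeta>" by (rule borel_integrable_atLeastAtMost')
    have "(LINT s:{0..t}|lborel. h s)
        = (LINT s:{0..t}|lborel. g s) + (LINT s:{0..t}|lborel. \<i> * complex_of_real \<omega> * \<zeta> s)"
      unfolding h_def
    proof (rule set_integral_add(2))
      show "set_integrable lborel {0..t} g" using \<zeta> by (simp add: is_wderiv_def)
      show "set_integrable lborel {0..t} (\<lambda>s. \<i> * complex_of_real \<omega> * \<zeta> s)"
        by (intro borel_integrable_atLeastAtMost' continuous_intros c)
    qed
    also have "(LINT s:{0..t}|lborel. \<i> * complex_of_real \<omega> * \<zeta> s) = \<i> * complex_of_real \<omega> * Z t"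
      using set_borel_integral_eq_integral(2)[OF i] by (simp add: Z_def)
    also have "(LINT s:{0..t}|lborel. g s) = \<zeta> t - \<zeta> 0"
      using is_wderiv_integral[OF \<zeta>, of 0 t] t by simp
    finally have "\<zeta> t - v t = (LINT s:{0..t}|lborel. h s)" by (simp add: v_def)
    then have "cmod (\<zeta> t - v t) \<le> sqrt ((t - 0) * energy period_measure h)"
      using norm_set_integral_le[OF h, of 0 t] t by simp
    also have "\<dots> \<le> \<eta>"
      unfolding \<eta> h_def using t by (intro real_sqrt_le_mono mult_right_mono energy_nonneg) auto
    finally show ?thesis .
  qed
  have E_deriv: "(E has_vector_derivative
      - \<i> * complex_of_real \<omega> * exp (complex_of_real t * (\<i> * complex_of_real \<omega>)) * (\<zeta> t - v t)) (at t within {0..2*pi})"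
    if t: "t \<in> {0..2*pi}" for t
  proof -
    have "(Z has_vector_derivative \<zeta> t) (at t within {0..2*pi})"
      unfolding Z_def by (rule integral_has_vector_derivative[OF cont t])
    then have v': "(v has_vector_derivative - \<i> * complex_of_real \<omega> * \<zeta> t) (at t within {0..2*pi})"
      unfolding v_def by (auto intro!: derivative_eq_intros)
    have e': "((\<lambda>t. exp (complex_of_real t * (\<i> * complex_of_real \<omega>))) has_vector_derivative
        \<i> * complex_of_real \<omega> * exp (complex_of_real t * (\<i> * complex_of_real \<omega>))) (at t within {0..2*pi})"
      using exp_scaleR_has_vector_derivative_left[of "\<i> * complex_of_real \<omega>" t]
      by (auto simp: scaleR_conv_of_real intro: has_vector_derivative_at_within)
    show ?thesis
      unfolding E_def using has_vector_derivative_mult[OF e' v']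
      by (rule has_vector_derivative_eq_rhs) (simp add: algebra_simps)
  qed
  \<comment> \<open>\<open>E 0 = \<zeta> 0\<close>, and the derivative of \<open>E\<close> has norm
    at most \<open>\<omega> * \<eta>\<close> because the exponential is unimodular.\<close>
  have E_bound: "cmod (E t - \<zeta> 0) \<le> 2*pi*\<omega> * \<eta>" if t: "t \<in> {0..2*pi}" for t
  proof -
    have nexp: "cmod (exp (complex_of_real s * (\<i> * complex_of_real \<omega>))) = 1" for s
      using norm_exp_i_times[of "s * \<omega>"] by (simp add: mult_ac)
    have "cmod (E t - E 0) \<le> \<omega> * \<eta> * norm (t - 0)"
    proof (rule differentiable_bound)
      let ?D = "\<lambda>s. - \<i> * complex_of_real \<omega> * exp (complex_of_real s * (\<i> * complex_of_real \<omega>)) * (\<zeta> s - v s)"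
      show "(E has_derivative (\<lambda>x. x *\<^sub>R ?D s)) (at s within {0..2*pi})" if "s \<in> {0..2*pi}" for s
        using E_deriv[OF that] by (simp add: has_vector_derivative_def)
      show "onorm (\<lambda>x. x *\<^sub>R ?D s) \<le> \<omega> * \<eta>" if "s \<in> {0..2*pi}" for s
      proof (rule onorm_le)
        have "cmod (?D s) \<le> \<omega> * \<eta>"
          using diff[OF that] \<omega> by (simp add: norm_mult nexp mult_left_mono)
        then show "norm (x *\<^sub>R ?D s) \<le> \<omega> * \<eta> * norm x" for x
          unfolding norm_scaleR real_norm_def mult.commute[of "\<bar>x\<bar>"] by (rule mult_right_mono) simp
      qed
    qed (use t in auto)
    also have "\<dots> \<le> \<omega> * \<eta> * (2*pi)"
      using t \<omega> \<eta>_nonneg by (intro mult_left_mono) auto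
    finally show ?thesis by (simp add: E_def v_def Z_def mult_ac)
  qed
  have vE: "cmod (v t) = cmod (E t)" for t
    using norm_exp_i_times[of "t * \<omega>"] by (simp add: E_def norm_mult mult_ac)
  show "cmod (\<zeta> t) \<le> cmod (\<zeta> 0) + (1 + 2*pi*\<omega>) * \<eta>" if t: "t \<in> {0..2*pi}"
  proof -
    have "cmod (\<zeta> t) \<le> cmod (v t) + cmod (\<zeta> t - v t)" by (rule norm_triangle_sub)
    moreover have "cmod (E t) \<le> cmod (\<zeta> 0) + cmod (E t - \<zeta> 0)" by (rule norm_triangle_sub)
    ultimately show ?thesis using diff[OF t] E_bound[OF t] vE[of t] by (simp add: algebra_simps)
  qed
  show "cmod (exp (\<i> * complex_of_real (2*pi*\<omega>)) - 1) * cmod (\<zeta> 0) \<le> (1 + 2*pi*\<omega>) * \<eta>"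
    if per: "\<zeta> (2*pi) = \<zeta> 0"
  proof -
    let ?e = "exp (complex_of_real (2*pi) * (\<i> * complex_of_real \<omega>))"
    have e1: "cmod ?e = 1" using norm_exp_i_times[of "2*pi*\<omega>"] by (simp add: mult_ac)
    have "exp (\<i> * complex_of_real (2*pi*\<omega>)) = ?e" by (simp add: mult_ac)
    then have "cmod (exp (\<i> * complex_of_real (2*pi*\<omega>)) - 1) * cmod (\<zeta> 0) = cmod ((?e - 1) * \<zeta> 0)"
      by (simp only: norm_mult)
    \<comment> \<open>\<open>?e * v (2*pi)\<close> is \<open>E (2*pi)\<close>, so periodicity of
      \<open>\<zeta>\<close> splits the left side into the drift of \<open>E\<close> and the
      endpoint error; they yield the summands \<open>2*pi*\<omega>\<close> and 1 of the
      constant.\<close>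
    also have "(?e - 1) * \<zeta> 0 = (E (2*pi) - \<zeta> 0) + ?e * (\<zeta> (2*pi) - v (2*pi))"
      using per by (simp add: E_def algebra_simps)
    also have "cmod \<dots> \<le> cmod (E (2*pi) - \<zeta> 0) + cmod (?e * (\<zeta> (2*pi) - v (2*pi)))"
      by (rule norm_triangle_ineq)
    also have "\<dots> \<le> 2*pi*\<omega> * \<eta> + \<eta>"
      using E_bound[of "2*pi"] diff[of "2*pi"] e1 by (simp add: norm_mult del: of_real_mult)
    finally show ?thesis by (simp add: algebra_simps)
  qed
qed

text \<open>Averaging \<open>x t - x s\<close> over \<open>s\<close> returns \<open>x t\<close>
  since the mean vanishes, and the Hoelder estimate bounds each difference over a length of at most
  \<open>2*pi\<close>.\<close>

lemma mean_zero_bound: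
  fixes x :: "real \<Rightarrow> real"
  assumes x: "is_wderiv x x'" and mean: "(LINT t:{0..2*pi}|lborel. x t) = 0" and t: "t \<in> {0..2*pi}"
  shows "\<bar>x t\<bar> \<le> sqrt (2*pi * energy period_measure x')"
proof -
  interpret finite_measure period_measure by (rule finite_period_measure)
  let ?\<eta> = "sqrt (2*pi * energy period_measure x')"
  have le: "\<bar>x t - x s\<bar> \<le> ?\<eta>" if s: "s \<in> {0..2*pi}" for s
  proof -
    have "norm (x t - x s) \<le> sqrt (\<bar>t - s\<bar> * energy period_measure x')"
      by (rule is_wderiv_Hoelder[OF x t s])
    also have "\<dots> \<le> ?\<eta>"
      using s t by (intro real_sqrt_le_mono mult_right_mono energy_nonneg) auto
    finally show ?thesis by simp
  qed
  have i: "integrable period_measure x"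
    by (intro sq_integrable_integrable[OF finite_period_measure] sq_integrable_continuous is_wderiv_continuous_on[OF x])
  have "(\<integral>s. x t - x s \<partial>period_measure) = 2*pi * x t"
    using i mean measure_period_measure by (simp add: set_integral_period)
  then have "2*pi * \<bar>x t\<bar> = \<bar>\<integral>s. x t - x s \<partial>period_measure\<bar>"
    by (simp add: abs_mult)
  also have "\<dots> \<le> (\<integral>s. \<bar>x t - x s\<bar> \<partial>period_measure)"
    using integral_norm_bound[of period_measure "\<lambda>s. x t - x s"] by simp
  also have "\<dots> \<le> (\<integral>s. ?\<eta> \<partial>period_measure)"
    using i le by (intro integral_mono) (auto simp: space_period_measure)
  also have "\<dots> = 2*pi * ?\<eta>"
    using measure_period_measure by simp
  finally show ?thesis by (simp add: mult_le_cancel_left)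
qed

section \<open>Lower semicontinuity of the action\<close>

text \<open>The inertial velocity up to a rotation, kept in the product space so that the kinetic
  action of a body is half of a single squared L2 norm.\<close>

definition rot_vel :: "real \<Rightarrow> (real \<Rightarrow> complex \<times> real) \<Rightarrow> real \<Rightarrow> complex \<times> real" where
  "rot_vel \<omega> f t = wderiv f t + (\<i> * complex_of_real \<omega> * fst (f t), 0)"

lemma norm_rot_vel_square:
  "(norm (rot_vel \<omega> f t))\<^sup>2 =
    (cmod (fst (wderiv f t) + \<i> * complex_of_real \<omega> * fst (f t)))\<^sup>2 + (snd (wderiv f t))\<^sup>2"
  by (simp add: rot_vel_def norm_prod_def)

lemma H1_loop_continuous_on: "H1_loop f \<Longrightarrow> continuous_on {0..2*pi} f"
  using H1_loop_wderiv is_wderiv_continuous_on by blast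

lemma sq_integrable_wderiv: "H1_loop f \<Longrightarrow> sq_integrable period_measure (wderiv f)"
  using H1_loop_wderiv is_wderiv_sq_integrable by blast

lemma sq_integrable_H1_loop: "H1_loop f \<Longrightarrow> sq_integrable period_measure f"
  by (intro sq_integrable_continuous H1_loop_continuous_on)

lemma sq_integrable_coriolis:
  "H1_loop f \<Longrightarrow> sq_integrable period_measure (\<lambda>t. (\<i> * complex_of_real \<omega> * fst (f t), 0::real))"
  by (intro sq_integrable_continuous continuous_intros H1_loop_continuous_on)

lemma sq_integrable_rot_vel:
  "H1_loop f \<Longrightarrow> sq_integrable period_measure (rot_vel \<omega> f)"
  unfolding rot_vel_def by (intro sq_integrable_add sq_integrable_wderiv sq_integrable_coriolis)

text \<open>In \<open>ennreal\<close> the inverse of 0 is \<open>top\<close>, which absorbs the case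
  distinction for collisions. The potential becomes a finite sum of continuous functions, hence
  measurable, and convergent along convergent configurations even at a collision.\<close>

lemma potential_eq:
  "potential N x = (\<Sum>i<N. \<Sum>j\<in>{i<..<N}. inverse (ennreal (norm (x i - x j))))"
proof (cases "\<exists>i<N. \<exists>j<N. i \<noteq> j \<and> x i = x j")
  case True
  then obtain i j where ij: "i < j" "j < N" "x i = x j"
    by (metis nat_neq_iff)
  have "top = inverse (ennreal (norm (x i - x j)))" using ij by simp
  also have "\<dots> \<le> (\<Sum>j\<in>{i<..<N}. inverse (ennreal (norm (x i - x j))))"
    using ij by (intro member_le_sum) auto
  also have "\<dots> \<le> (\<Sum>i<N. \<Sum>j\<in>{i<..<N}. inverse (ennreal (norm (x i - x j))))"
    using ij by (intro member_le_sum[where f="\<lambda>i. \<Sum>j\<in>{i<..<N}. inverse (ennreal (norm (x i - x j)))"]) auto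
  finally have "(\<Sum>i<N. \<Sum>j\<in>{i<..<N}. inverse (ennreal (norm (x i - x j)))) = top"
    by (simp only: top_unique)
  then show ?thesis using True by (simp only: potential_def if_True infinity_ennreal_def)
next
  case False
  then have "potential N x = (\<Sum>i<N. \<Sum>j\<in>{i<..<N}. ennreal (1 / norm (x i - x j)))"
    by (auto simp: potential_def)
  also have "\<dots> = (\<Sum>i<N. \<Sum>j\<in>{i<..<N}. inverse (ennreal (norm (x i - x j))))"
  proof (intro sum.cong refl)
    fix i j assume "i \<in> {..<N}" "j \<in> {i<..<N}"
    then have "x i \<noteq> x j" using False less_trans[of i j N] by (metis greaterThanLessThan_iff less_irrefl)
    then show "ennreal (1 / norm (x i - x j)) = inverse (ennreal (norm (x i - x j)))"
      by (simp add: inverse_ennreal inverse_eq_divide)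
  qed
  finally show ?thesis .
qed

lemma potential_tendsto:
  assumes "\<And>i. i < N \<Longrightarrow> (\<lambda>n. x n i) \<longlonglongrightarrow> y i"
  shows "(\<lambda>n. potential N (x n)) \<longlonglongrightarrow> potential N y"
  unfolding potential_eq
proof (intro tendsto_sum)
  fix i j assume "i \<in> {..<N}" "j \<in> {i<..<N}"
  then have "(\<lambda>n. ennreal (norm (x n i - x n j))) \<longlonglongrightarrow> ennreal (norm (y i - y j))"
    by (intro tendsto_ennrealI tendsto_intros assms) auto
  then show "(\<lambda>n. inverse (ennreal (norm (x n i - x n j)))) \<longlonglongrightarrow> inverse (ennreal (norm (y i - y j)))"
    by (rule continuous_on_tendsto_compose[OF continuous_on_inverse_ennreal[OF continuous_on_id[of UNIV]]]) auto
qed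

lemma borel_measurable_potential:
  assumes "in_Lambda N q"
  shows "(\<lambda>t. potential N (\<lambda>i. q i t)) \<in> borel_measurable period_measure"
  unfolding potential_eq
proof (intro borel_measurable_sum)
  fix i j assume "i \<in> {..<N}" "j \<in> {i<..<N}"
  then have [measurable]: "q i \<in> borel_measurable period_measure" "q j \<in> borel_measurable period_measure"
    using assms by (auto simp: in_Lambda_def intro!: borel_measurable_period_continuous H1_loop_continuous_on)
  show "(\<lambda>t. inverse (ennreal (norm (q i t - q j t)))) \<in> borel_measurable period_measure"
    by measurable
qed

lemma action_eq:
  assumes q: "in_Lambda N q"
  shows "action N \<omega> q 0 (2*pi) = ennreal (1/2 * (\<Sum>i<N. energy period_measure (rot_vel \<omega> (q i))))
    + (\<integral>\<^sup>+t. potential N (\<lambda>i. q i t) \<partial>period_measure)"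
proof -
  have i: "integrable period_measure (\<lambda>t. (norm (rot_vel \<omega> (q i) t))\<^sup>2)" if "i < N" for i
    using q that by (intro sq_integrable_norm_square sq_integrable_rot_vel) (simp add: in_Lambda_def)
  then have int: "integrable period_measure (\<lambda>t. 1/2 * (\<Sum>i<N. (norm (rot_vel \<omega> (q i) t))\<^sup>2))"
    by (intro integrable_mult_right Bochner_Integration.integrable_sum) auto
  have "action N \<omega> q 0 (2*pi) = (\<integral>\<^sup>+t. ennreal (1/2 * (\<Sum>i<N. (norm (rot_vel \<omega> (q i) t))\<^sup>2))
      + potential N (\<lambda>i. q i t) \<partial>period_measure)"
    unfolding action_def norm_rot_vel_square by (rule nn_integral_restrict_space[symmetric]) simp
  also have "\<dots> = (\<integral>\<^sup>+t. ennreal (1/2 * (\<Sum>i<N. (norm (rot_vel \<omega> (q i) t))\<^sup>2)) \<partial>period_measure)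
      + (\<integral>\<^sup>+t. potential N (\<lambda>i. q i t) \<partial>period_measure)"
    using borel_measurable_integrable[OF int] borel_measurable_potential[OF q]
    by (intro nn_integral_add) auto
  also have "(\<integral>\<^sup>+t. ennreal (1/2 * (\<Sum>i<N. (norm (rot_vel \<omega> (q i) t))\<^sup>2)) \<partial>period_measure)
      = ennreal (\<integral>t. 1/2 * (\<Sum>i<N. (norm (rot_vel \<omega> (q i) t))\<^sup>2) \<partial>period_measure)"
    by (intro nn_integral_eq_integral int) (auto intro!: sum_nonneg)
  also have "(\<integral>t. 1/2 * (\<Sum>i<N. (norm (rot_vel \<omega> (q i) t))\<^sup>2) \<partial>period_measure)
      = 1/2 * (\<Sum>i<N. energy period_measure (rot_vel \<omega> (q i)))"
    using i by (simp add: energy_def Bochner_Integration.integral_sum)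
  finally show ?thesis .
qed

lemma energy_rot_vel_le_action:
  assumes q: "in_Lambda N q" and le: "action N \<omega> q 0 (2*pi) \<le> ennreal A" and A: "0 \<le> A" and i: "i < N"
  shows "energy period_measure (rot_vel \<omega> (q i)) \<le> 2 * A"
proof -
  have "energy period_measure (rot_vel \<omega> (q i)) \<le> (\<Sum>i<N. energy period_measure (rot_vel \<omega> (q i)))"
    using i by (intro member_le_sum[where f="\<lambda>i. energy period_measure (rot_vel \<omega> (q i))"]) (auto simp: energy_nonneg)
  moreover have "ennreal (1/2 * (\<Sum>i<N. energy period_measure (rot_vel \<omega> (q i)))) \<le> ennreal A"
    using le unfolding action_eq[OF q] by (rule order_trans[OF le_iff_add[THEN iffD2], OF exI, OF refl])
  then have "1/2 * (\<Sum>i<N. energy period_measure (rot_vel \<omega> (q i))) \<le> A"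
    using A by simp
  ultimately show ?thesis by simp
qed

lemma inner_integral_bounded_convergence:
  fixes f :: "nat \<Rightarrow> real \<Rightarrow> 'a::euclidean_space"
  assumes f: "\<And>n. f n \<in> borel_measurable period_measure" and F: "F \<in> borel_measurable period_measure"
    and bound: "\<And>n t. t \<in> {0..2*pi} \<Longrightarrow> norm (f n t) \<le> B"
    and lim: "\<And>t. t \<in> {0..2*pi} \<Longrightarrow> (\<lambda>n. f n t) \<longlonglongrightarrow> F t"
    and \<psi>: "sq_integrable period_measure \<psi>"
  shows "(\<lambda>n. \<integral>t. f n t \<bullet> \<psi> t \<partial>period_measure) \<longlonglongrightarrow> (\<integral>t. F t \<bullet> \<psi> t \<partial>period_measure)"
proof (rule integral_dominated_convergence)
  note sq_integrable_measurable[OF \<psi>, measurable] f[measurable] F[measurable]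
  show "(\<lambda>t. F t \<bullet> \<psi> t) \<in> borel_measurable period_measure"
    "(\<lambda>t. f n t \<bullet> \<psi> t) \<in> borel_measurable period_measure" for n
    by measurable
  show "integrable period_measure (\<lambda>t. B * norm (\<psi> t))"
    using sq_integrable_integrable_norm[OF finite_period_measure \<psi>] by simp
  show "AE t in period_measure. (\<lambda>n. f n t \<bullet> \<psi> t) \<longlonglongrightarrow> F t \<bullet> \<psi> t"
    using lim by (intro AE_I2 tendsto_intros) (auto simp: space_period_measure)
  have "norm (f n t \<bullet> \<psi> t) \<le> B * norm (\<psi> t)" if "t \<in> {0..2*pi}" for n t
    using Cauchy_Schwarz_ineq2[of "f n t" "\<psi> t"] mult_right_mono[OF bound[OF that, of n] norm_ge_zero[of "\<psi> t"]]
    by simp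
  then show "AE t in period_measure. norm (f n t \<bullet> \<psi> t) \<le> B * norm (\<psi> t)" for n
    by (intro AE_I2) (auto simp: space_period_measure)
qed

text \<open>The derivative converges only weakly, the Coriolis term pointwise and boundedly, hence
  by dominated convergence.\<close>

lemma rot_vel_weak_limit:
  assumes f: "\<And>n. H1_loop (f n)" and bound: "\<And>n. energy period_measure (wderiv (f n)) \<le> C"
    and B: "\<And>n t. t \<in> {0..2*pi} \<Longrightarrow> norm (f n t) \<le> B"
    and lim: "\<And>t. (\<lambda>n. f n t) \<longlonglongrightarrow> F t" and \<psi>: "sq_integrable period_measure \<psi>"
  shows "(\<lambda>n. \<integral>t. rot_vel \<omega> (f n) t \<bullet> \<psi> t \<partial>period_measure) \<longlonglongrightarrow> (\<integral>t. rot_vel \<omega> F t \<bullet> \<psi> t \<partial>period_measure)"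
proof -
  let ?c = "\<lambda>f t. (\<i> * complex_of_real \<omega> * fst (f t), 0::real)"
  have F: "H1_loop F" by (rule H1_loop_limit(1)[OF f bound lim])
  have split: "(\<integral>t. rot_vel \<omega> h t \<bullet> \<psi> t \<partial>period_measure)
      = (\<integral>t. wderiv h t \<bullet> \<psi> t \<partial>period_measure) + (\<integral>t. ?c h t \<bullet> \<psi> t \<partial>period_measure)"
    if "H1_loop h" for h
    unfolding rot_vel_def inner_add_left
    using sq_integrable_inner[OF sq_integrable_wderiv[OF that] \<psi>] sq_integrable_inner[OF sq_integrable_coriolis[OF that] \<psi>]
    by (intro Bochner_Integration.integral_add) auto
  have "norm (?c (f n) t) \<le> \<bar>\<omega>\<bar> * B" if "t \<in> {0..2*pi}" for n t
  proof -
    have "norm (?c (f n) t) = \<bar>\<omega>\<bar> * cmod (fst (f n t))" by (simp add: norm_Pair norm_mult)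
    also have "cmod (fst (f n t)) \<le> B" using B[OF that, of n] norm_fst_le[of "fst (f n t)" "snd (f n t)"] by simp
    finally show ?thesis by (simp add: mult_left_mono)
  qed
  then have "(\<lambda>n. \<integral>t. ?c (f n) t \<bullet> \<psi> t \<partial>period_measure) \<longlonglongrightarrow> (\<integral>t. ?c F t \<bullet> \<psi> t \<partial>period_measure)"
    by (intro inner_integral_bounded_convergence[where B="\<bar>\<omega>\<bar> * B"] tendsto_intros lim \<psi>
        sq_integrable_measurable[OF sq_integrable_coriolis] f F) auto
  then show ?thesis
    unfolding split[OF f] split[OF F] by (intro tendsto_add H1_loop_limit(2)[OF f bound lim \<psi>])
qed

text \<open>By convexity the kinetic part at \<open>q n\<close> lies above its tangent at
  \<open>Q\<close>, and the linear term tends to 0 by weak convergence. The potential converges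
  pointwise, so Fatou's lemma applies to it.\<close>

lemma action_lower_semicontinuous:
  assumes q: "\<And>n. in_Lambda N (q n)"
    and C: "\<And>n i. i < N \<Longrightarrow> energy period_measure (wderiv (q n i)) \<le> C"
    and B: "\<And>n i t. i < N \<Longrightarrow> norm (q n i t) \<le> B"
    and lim: "\<And>i t. i < N \<Longrightarrow> (\<lambda>n. q n i t) \<longlonglongrightarrow> Q i t"
    and I: "(\<lambda>n. action N \<omega> (q n) 0 (2*pi)) \<longlonglongrightarrow> I"
  shows "action N \<omega> Q 0 (2*pi) \<le> I"
proof -
  have H1: "H1_loop (q n i)" if "i < N" for n i using q that by (simp add: in_Lambda_def)
  have QH1: "H1_loop (Q i)" if "i < N" for i
    by (rule H1_loop_limit(1)[of "\<lambda>n. q n i" C, OF H1[OF that] C[OF that] lim[OF that]])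
  then have Q: "in_Lambda N Q" by (simp add: in_Lambda_def)
  define V where "V f = rot_vel \<omega> f" for f
  define K where "K = 1/2 * (\<Sum>i<N. energy period_measure (V (Q i)))"
  \<comment> \<open>Minus the linear term of the tangent at \<open>Q\<close>; it pairs the
    velocities of \<open>q n\<close> with the fixed test functions \<open>V (Q i)\<close>.\<close>
  define \<delta> where "\<delta> n = (\<Sum>i<N. energy period_measure (V (Q i)) - (\<integral>t. V (q n i) t \<bullet> V (Q i) t \<partial>period_measure))" for n
  let ?U = "\<lambda>q. \<integral>\<^sup>+t. potential N (\<lambda>i. q i t) \<partial>period_measure"
  have "\<delta> \<longlonglongrightarrow> (\<Sum>i<N. energy period_measure (V (Q i)) - (\<integral>t. V (Q i) t \<bullet> V (Q i) t \<partial>period_measure))"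
    unfolding \<delta>_def V_def
    by (intro tendsto_intros rot_vel_weak_limit[of "\<lambda>n. q n i" C B "Q i" for i] sq_integrable_rot_vel)
       (use H1 QH1 C B lim in auto)
  then have \<delta>: "\<delta> \<longlonglongrightarrow> 0" by (simp add: energy_def power2_norm_eq_inner)
  have K_le: "K \<le> 1/2 * (\<Sum>i<N. energy period_measure (V (q n i))) + \<bar>\<delta> n\<bar>" for n
  proof -
    have "energy period_measure (V (Q i)) / 2 \<le> energy period_measure (V (q n i)) / 2
        + (energy period_measure (V (Q i)) - (\<integral>t. V (q n i) t \<bullet> V (Q i) t \<partial>period_measure))" if "i < N" for i
      using energy_diff[OF sq_integrable_rot_vel[OF H1[OF that, of n]] sq_integrable_rot_vel[OF QH1[OF that]], of \<omega> \<omega>]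
        energy_nonneg[of period_measure "\<lambda>t. V (q n i) t - V (Q i) t"]
      unfolding V_def by argo
    then have "(\<Sum>i<N. energy period_measure (V (Q i)) / 2) \<le> (\<Sum>i<N. energy period_measure (V (q n i)) / 2
        + (energy period_measure (V (Q i)) - (\<integral>t. V (q n i) t \<bullet> V (Q i) t \<partial>period_measure)))"
      by (intro sum_mono) auto
    then have "K \<le> 1/2 * (\<Sum>i<N. energy period_measure (V (q n i))) + \<delta> n"
      unfolding K_def \<delta>_def sum.distrib by (simp add: sum_divide_distrib)
    then show ?thesis by linarith
  qed
  \<comment> \<open>The error stands on the right, in absolute value, so that nothing is subtracted
    from a possibly infinite action.\<close>
  have le: "?U (q n) + ennreal K \<le> action N \<omega> (q n) 0 (2*pi) + ennreal \<bar>\<delta> n\<bar>" for n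
  proof -
    let ?k = "1/2 * (\<Sum>i<N. energy period_measure (V (q n i)))"
    have "0 \<le> ?k" by (simp add: energy_nonneg sum_nonneg)
    then have "ennreal K \<le> ennreal ?k + ennreal \<bar>\<delta> n\<bar>"
      using K_le[of n] by (simp add: ennreal_leI flip: ennreal_plus)
    then have "?U (q n) + ennreal K \<le> ?U (q n) + (ennreal ?k + ennreal \<bar>\<delta> n\<bar>)"
      by (rule add_left_mono)
    then show ?thesis unfolding action_eq[OF q] V_def by (simp add: ac_simps)
  qed
  have "?U Q = (\<integral>\<^sup>+t. liminf (\<lambda>n. potential N (\<lambda>i. q n i t)) \<partial>period_measure)"
    using potential_tendsto[of N "\<lambda>n i. q n i t" "\<lambda>i. Q i t" for t] lim
    by (intro nn_integral_cong lim_imp_Liminf[symmetric]) auto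
  also have "\<dots> \<le> liminf (\<lambda>n. ?U (q n))"
    by (intro nn_integral_liminf borel_measurable_potential q)
  finally have "?U Q + ennreal K \<le> liminf (\<lambda>n. ?U (q n)) + ennreal K"
    by (rule add_right_mono)
  also have "\<dots> = liminf (\<lambda>n. ?U (q n) + ennreal K)"
    by (rule Liminf_add_const[symmetric]) simp
  also have "\<dots> \<le> liminf (\<lambda>n. action N \<omega> (q n) 0 (2*pi) + ennreal \<bar>\<delta> n\<bar>)"
    using le by (intro Liminf_mono always_eventually) auto
  also have "\<dots> = I"
  proof (rule lim_imp_Liminf)
    have "(\<lambda>n. ennreal \<bar>\<delta> n\<bar>) \<longlonglongrightarrow> ennreal \<bar>0\<bar>"
      by (intro tendsto_ennrealI tendsto_rabs \<delta>)
    then show "(\<lambda>n. action N \<omega> (q n) 0 (2*pi) + ennreal \<bar>\<delta> n\<bar>) \<longlonglongrightarrow> I"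
      using tendsto_add[OF I] by fastforce
  qed simp
  finally show ?thesis
    unfolding action_eq[OF Q] K_def V_def by (simp add: add.commute)
qed

section \<open>Compactness and existence of minimisers\<close>

lemma H1_loop_periodic: "H1_loop f \<Longrightarrow> f (t + 2*pi * of_int k) = f t"
  by (intro periodic_shift_int) (simp add: H1_loop_def)

lemma Lambda_DN_H1_loop: "Lambda_DN N q \<Longrightarrow> i < N \<Longrightarrow> H1_loop (q i)"
  by (simp add: Lambda_DN_def in_Lambda_def)

lemma Lambda_DN_norm_le:
  assumes q: "Lambda_DN N q" and i: "i < N" and B: "\<And>s. s \<in> {0..2*pi} \<Longrightarrow> norm (q 0 s) \<le> B"
  shows "norm (q i t) \<le> B"
proof -
  obtain s k where s: "s \<in> {0..2*pi}" "t + 2*pi * real i / real N = s + 2*pi * of_int k"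
    using period_representative by blast
  have "q i t = q 0 (t + 2*pi * real i / real N)" using q i unfolding Lambda_DN_def by blast
  also have "\<dots> = q 0 s" unfolding s(2) using Lambda_DN_H1_loop[OF q, of 0] i by (intro H1_loop_periodic) auto
  finally show ?thesis using B[OF s(1)] by simp
qed

lemma H1_inner_tendsto:
  assumes q: "\<And>n. in_Lambda N (q n)" and h: "in_Lambda N h"
    and C: "\<And>n i. i < N \<Longrightarrow> energy period_measure (wderiv (q n i)) \<le> C"
    and B: "\<And>n i t. i < N \<Longrightarrow> norm (q n i t) \<le> B"
    and lim: "\<And>i t. i < N \<Longrightarrow> (\<lambda>n. q n i t) \<longlonglongrightarrow> Q i t"
  shows "(\<lambda>n. H1_inner N (q n) h) \<longlonglongrightarrow> H1_inner N Q h"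
  unfolding H1_inner_def
proof (rule tendsto_sum)
  fix i assume "i \<in> {..<N}"
  then have i: "i < N" by simp
  have H1: "H1_loop (q n i)" for n using q i by (simp add: in_Lambda_def)
  have hi: "H1_loop (h i)" using h i by (simp add: in_Lambda_def)
  have Qi: "H1_loop (Q i)" by (rule H1_loop_limit(1)[of "\<lambda>n. q n i" C, OF H1 C[OF i] lim[OF i]])
  have split: "(LINT t:{0..2*pi}|lborel. (f t \<bullet> h i t + wderiv f t \<bullet> wderiv (h i) t))
      = (\<integral>t. f t \<bullet> h i t \<partial>period_measure) + (\<integral>t. wderiv f t \<bullet> wderiv (h i) t \<partial>period_measure)"
    if "H1_loop f" for f
    unfolding set_integral_period
    by (intro Bochner_Integration.integral_add sq_integrable_inner sq_integrable_H1_loop sq_integrable_wderiv that hi)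
  have "(\<lambda>n. \<integral>t. q n i t \<bullet> h i t \<partial>period_measure) \<longlonglongrightarrow> (\<integral>t. Q i t \<bullet> h i t \<partial>period_measure)"
    by (intro inner_integral_bounded_convergence[where B=B] B i lim sq_integrable_H1_loop hi
        sq_integrable_measurable[OF sq_integrable_H1_loop] H1 Qi)
  moreover have "(\<lambda>n. \<integral>t. wderiv (q n i) t \<bullet> wderiv (h i) t \<partial>period_measure)
      \<longlonglongrightarrow> (\<integral>t. wderiv (Q i) t \<bullet> wderiv (h i) t \<partial>period_measure)"
    by (rule H1_loop_limit(2)[of "\<lambda>n. q n i" C, OF H1 C[OF i] lim[OF i] sq_integrable_wderiv[OF hi]])
  ultimately show "(\<lambda>n. LINT t:{0..2*pi}|lborel. (q n i t \<bullet> h i t + wderiv (q n i) t \<bullet> wderiv (h i) t))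
      \<longlonglongrightarrow> (LINT t:{0..2*pi}|lborel. (Q i t \<bullet> h i t + wderiv (Q i) t \<bullet> wderiv (h i) t))"
    unfolding split[OF H1] split[OF Qi] by (rule tendsto_add)
qed

text \<open>The closure is defined through neighbourhoods, each with finitely many test loops. One
  index \<open>n\<close> is within \<open>\<epsilon> / 2\<close> for all of them, and an element of
  \<open>S\<close> near \<open>q n\<close> accounts for the other half.\<close>

lemma weak_closure_DN_limit:
  assumes q: "\<And>n. q n \<in> weak_closure_DN N S" and Q: "Lambda_DN N Q"
    and C: "\<And>n i. i < N \<Longrightarrow> energy period_measure (wderiv (q n i)) \<le> C"
    and B: "\<And>n i t. i < N \<Longrightarrow> norm (q n i t) \<le> B"
    and lim: "\<And>i t. i < N \<Longrightarrow> (\<lambda>n. q n i t) \<longlonglongrightarrow> Q i t"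
  shows "Q \<in> weak_closure_DN N S"
  unfolding weak_closure_DN_def
proof (intro CollectI conjI allI impI Q)
  fix H and \<epsilon> :: real
  assume H: "finite H" "H \<subseteq> {h. in_Lambda N h}" and \<epsilon>: "0 < \<epsilon>"
  have q_in: "in_Lambda N (q n)" for n
    using q[of n] by (simp add: weak_closure_DN_def Lambda_DN_def)
  have "\<forall>\<^sub>F n in sequentially. \<bar>H1_inner N (q n) h - H1_inner N Q h\<bar> < \<epsilon> / 2" if "h \<in> H" for h
  proof -
    have "(\<lambda>n. H1_inner N (q n) h) \<longlonglongrightarrow> H1_inner N Q h"
      using H that by (intro H1_inner_tendsto[OF q_in _ C B lim]) auto
    from tendstoD[OF this, of "\<epsilon> / 2"] show ?thesis using \<epsilon> by (simp add: dist_real_def)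
  qed
  then have "\<forall>\<^sub>F n in sequentially. \<forall>h\<in>H. \<bar>H1_inner N (q n) h - H1_inner N Q h\<bar> < \<epsilon> / 2"
    using H(1) by (simp add: eventually_ball_finite)
  then obtain n where n: "\<And>h. h \<in> H \<Longrightarrow> \<bar>H1_inner N (q n) h - H1_inner N Q h\<bar> < \<epsilon> / 2"
    by (metis (no_types, lifting) eventually_sequentially order_refl)
  have "\<exists>p\<in>S. \<forall>h\<in>H. \<bar>H1_inner N p h - H1_inner N (q n) h\<bar> < \<epsilon> / 2"
    using q[of n] H \<epsilon> unfolding weak_closure_DN_def by (blast dest: half_gt_zero)
  then obtain p where p: "p \<in> S" "\<And>h. h \<in> H \<Longrightarrow> \<bar>H1_inner N p h - H1_inner N (q n) h\<bar> < \<epsilon> / 2"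
    by blast
  have "\<bar>H1_inner N p h - H1_inner N Q h\<bar> < \<epsilon>" if "h \<in> H" for h
    using n[OF that] p(2)[OF that] by linarith
  then show "\<exists>p\<in>S. \<forall>h\<in>H. \<bar>H1_inner N p h - H1_inner N Q h\<bar> < \<epsilon>"
    using p(1) by blast
qed

text \<open>Equicontinuity of body 0 on one period suffices: periodicity spreads the convergence
  over the line, and the other bodies are time shifts of body 0.\<close>

lemma Lambda_DN_compactness:
  assumes N: "0 < N" and q: "\<And>n. Lambda_DN N (q n)"
    and C: "\<And>n i. i < N \<Longrightarrow> energy period_measure (wderiv (q n i)) \<le> C"
    and B: "\<And>n t. t \<in> {0..2*pi} \<Longrightarrow> norm (q n 0 t) \<le> B"
  obtains r Q where "strict_mono (r :: nat \<Rightarrow> nat)" "Lambda_DN N Q"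
    "\<And>i t. i < N \<Longrightarrow> (\<lambda>n. q (r n) i t) \<longlonglongrightarrow> Q i t"
proof -
  have H1: "H1_loop (q n i)" if "i < N" for n i by (rule Lambda_DN_H1_loop[OF q that])
  obtain g r where g: "continuous_on {0..2*pi} g" and r: "strict_mono (r :: nat \<Rightarrow> nat)"
    and conv: "\<And>e. 0 < e \<Longrightarrow> \<exists>k. \<forall>n t. n \<ge> k \<and> t \<in> {0..2*pi} \<longrightarrow> norm (q (r n) 0 t - g t) < e"
  proof (rule Arzela_Ascoli[of "{0..2*pi}" "\<lambda>n. q n 0" B])
    fix t e :: real assume t: "t \<in> {0..2*pi}" and e: "0 < e"
    have C0: "0 \<le> C" using C[OF N, of 0] energy_nonneg order_trans by blast
    have "norm (q n 0 t - q n 0 s) < e" if s: "s \<in> {0..2*pi}" "norm (t - s) < e\<^sup>2 / (C + 1)" for n s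
    proof -
      have "norm (q n 0 t - q n 0 s) \<le> sqrt (\<bar>t - s\<bar> * energy period_measure (wderiv (q n 0)))"
        by (rule is_wderiv_Hoelder[OF H1_loop_wderiv[OF H1[OF N]] t s(1)])
      also have "\<dots> \<le> sqrt (\<bar>t - s\<bar> * (C + 1))"
        using C[OF N, of n] by (intro real_sqrt_le_mono mult_left_mono) auto
      also have "\<dots> < sqrt (e\<^sup>2)"
        using s(2) C0 by (intro real_sqrt_less_mono) (simp add: field_simps)
      finally show ?thesis using e by simp
    qed
    then show "\<exists>d>0. \<forall>n s. s \<in> {0..2*pi} \<and> norm (t - s) < d \<longrightarrow> norm (q n 0 t - q n 0 s) < e"
      using e C0 by (intro exI[of _ "e\<^sup>2 / (C + 1)"]) auto
  qed (use B in auto)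
  have "convergent (\<lambda>n. q (r n) 0 t)" for t
  proof -
    obtain s k where s: "s \<in> {0..2*pi}" "t = s + 2*pi * of_int k"
      using period_representative by blast
    have "(\<lambda>n. q (r n) 0 s) \<longlonglongrightarrow> g s"
      using conv s(1) by (fastforce simp: LIMSEQ_iff)
    then have "(\<lambda>n. q (r n) 0 t) \<longlonglongrightarrow> g s"
      unfolding s(2) using H1_loop_periodic[OF H1[OF N]] by simp
    then show ?thesis by (rule convergentI)
  qed
  then have lim0: "(\<lambda>n. q (r n) 0 t) \<longlonglongrightarrow> lim (\<lambda>n. q (r n) 0 t)" for t
    by (simp add: convergent_LIMSEQ_iff)
  \<comment> \<open>Built from body 0 alone, so that the shift relation holds by definition.\<close>
  define Q where "Q i t = lim (\<lambda>n. q (r n) 0 (t + 2*pi * real i / real N))" for i :: nat and t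
  have shift: "q n i t = q n 0 (t + 2*pi * real i / real N)" if "i < N" for n i t
    using q[of n] that unfolding Lambda_DN_def by blast
  have lim: "(\<lambda>n. q (r n) i t) \<longlonglongrightarrow> Q i t" if "i < N" for i t
    using lim0[of "t + 2*pi * real i / real N"] unfolding Q_def shift[OF that] .
  have "H1_loop (Q i)" if "i < N" for i
    by (rule H1_loop_limit(1)[of "\<lambda>n. q (r n) i" C, OF H1[OF that] C[OF that] lim[OF that]])
  moreover have "Q i t = Q 0 (t + 2*pi * real i / real N)" for i t
    by (simp add: Q_def)
  moreover have "Q 0 (2*pi - t) = refl_xz (Q 0 t)" for t
  proof (rule LIMSEQ_unique[OF lim[OF N]])
    have "q (r n) 0 (2*pi - t) = refl_xz (q (r n) 0 t)" for n
      using q[of "r n"] unfolding Lambda_DN_def by blast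
    then show "(\<lambda>n. q (r n) 0 (2*pi - t)) \<longlonglongrightarrow> refl_xz (Q 0 t)"
      unfolding refl_xz_def by (auto intro!: tendsto_intros lim[OF N])
  qed
  ultimately have "Lambda_DN N Q" unfolding Lambda_DN_def in_Lambda_def by blast
  with r lim that show ?thesis by blast
qed

text \<open>Removing the Coriolis term from the rotating velocity costs its energy, which a uniform
  bound on the loop controls; the factors 2 in front come from \<open>energy_add_le\<close>.\<close>

lemma energy_wderiv_le:
  assumes f: "H1_loop f" and A: "energy period_measure (rot_vel \<omega> f) \<le> A"
    and B: "\<And>t. t \<in> {0..2*pi} \<Longrightarrow> norm (f t) \<le> B"
  shows "energy period_measure (wderiv f) \<le> 2 * A + 2 * (2*pi * (\<bar>\<omega>\<bar> * B)\<^sup>2)"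
proof -
  let ?c = "\<lambda>t. (\<i> * complex_of_real (- \<omega>) * fst (f t), 0::real)"
  have "wderiv f = (\<lambda>t. rot_vel \<omega> f t + ?c t)"
    by (auto simp: rot_vel_def fun_eq_iff prod_eq_iff)
  then have "energy period_measure (wderiv f) \<le> 2 * energy period_measure (rot_vel \<omega> f) + 2 * energy period_measure ?c"
    using energy_add_le[OF sq_integrable_rot_vel[OF f, of \<omega>] sq_integrable_coriolis[OF f, of "- \<omega>"]] by simp
  moreover have "energy period_measure ?c \<le> 2*pi * (\<bar>\<omega>\<bar> * B)\<^sup>2"
  proof (rule energy_bounded)
    show "?c \<in> borel_measurable period_measure"
      by (rule sq_integrable_measurable[OF sq_integrable_coriolis[OF f]])
    show "norm (?c t) \<le> \<bar>\<omega>\<bar> * B" if "t \<in> {0..2*pi}" for t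
    proof -
      have "norm (?c t) = \<bar>\<omega>\<bar> * cmod (fst (f t))" by (simp add: norm_Pair norm_mult)
      moreover have "cmod (fst (f t)) \<le> B" using B[OF that] norm_fst_le[of "fst (f t)" "snd (f t)"] by simp
      ultimately show ?thesis by (simp add: mult_left_mono)
    qed
  qed
  ultimately show ?thesis using A by linarith
qed

lemma Lambda_DN_xi_Lambda_DN: "q \<in> Lambda_DN_xi N \<xi> \<Longrightarrow> Lambda_DN N q"
  by (simp add: Lambda_DN_xi_def weak_closure_DN_def)

text \<open>\<open>P\<close> stands for the conditions on the means. Coercivity is asked only up to
  replacing a loop by one of no larger action, which accommodates a noncompact symmetry of the
  action.\<close>

lemma action_minimiser_exists:
  assumes N: "0 < N" and ne: "\<exists>q \<in> Lambda_DN_xi N \<xi>. P q"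
    and coercive: "\<And>A. \<exists>B. \<forall>q\<in>Lambda_DN_xi N \<xi>. P q \<longrightarrow> action N \<omega> q 0 (2*pi) \<le> ennreal A \<longrightarrow>
      (\<exists>q'\<in>Lambda_DN_xi N \<xi>. P q' \<and> action N \<omega> q' 0 (2*pi) \<le> action N \<omega> q 0 (2*pi) \<and>
        (\<forall>t\<in>{0..2*pi}. norm (q' 0 t) \<le> B))"
    and closed: "\<And>q Q B. (\<And>n. Lambda_DN N (q n)) \<Longrightarrow> (\<And>n. P (q n)) \<Longrightarrow> Lambda_DN N Q \<Longrightarrow>
      (\<And>n t. norm (q n 0 t) \<le> B) \<Longrightarrow> (\<And>t. (\<lambda>n. q n 0 t) \<longlonglongrightarrow> Q 0 t) \<Longrightarrow> P Q"
  shows "\<exists>q\<in>{q \<in> Lambda_DN_xi N \<xi>. P q}. \<forall>p\<in>{q \<in> Lambda_DN_xi N \<xi>. P q}.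
    action N \<omega> q 0 (2*pi) \<le> action N \<omega> p 0 (2*pi)"
proof -
  let ?S = "{q \<in> Lambda_DN_xi N \<xi>. P q}" and ?act = "\<lambda>q. action N \<omega> q 0 (2*pi)"
  define I where "I = (INF q\<in>?S. ?act q)"
  have I_le: "I \<le> ?act p" if "p \<in> ?S" for p
    unfolding I_def by (rule INF_lower[OF that])
  show ?thesis
  \<comment> \<open>If the infimum is infinite, every admissible loop has infinite action and any of
    them is a minimiser.\<close>
  proof (cases "I = top")
    case True
    then have "?act p = top" if "p \<in> ?S" for p using I_le[OF that] by (simp add: top_unique)
    then show ?thesis using ne by force
  next
    case False
    then obtain a where a: "0 \<le> a" "I = ennreal a" by (cases I) auto
    have approx: "\<exists>p\<in>?S. ?act p < I + ennreal (1 / real (Suc n))" for n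
    proof -
      have "I < I + ennreal (1 / real (Suc n))"
        using a by (simp add: ennreal_less_iff flip: ennreal_plus)
      then show ?thesis unfolding I_def by (simp add: INF_less_iff)
    qed
    \<comment> \<open>The errors \<open>1 / real (Suc n)\<close> are at most 1, so the level
      \<open>a + 1\<close> and one bound \<open>B\<close> serve the whole sequence.\<close>
    obtain B where B: "\<And>q. q \<in> ?S \<Longrightarrow> ?act q \<le> ennreal (a + 1) \<Longrightarrow>
        \<exists>q'\<in>?S. ?act q' \<le> ?act q \<and> (\<forall>t\<in>{0..2*pi}. norm (q' 0 t) \<le> B)"
      using coercive[of "a + 1"] by blast
    have "\<exists>q\<in>?S. ?act q \<le> I + ennreal (1 / real (Suc n)) \<and> (\<forall>t\<in>{0..2*pi}. norm (q 0 t) \<le> B)" for n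
    proof -
      obtain p where p: "p \<in> ?S" "?act p < I + ennreal (1 / real (Suc n))" using approx by blast
      have "I + ennreal (1 / real (Suc n)) \<le> ennreal (a + 1)"
        using a by (simp add: ennreal_leI flip: ennreal_plus)
      then have "?act p \<le> ennreal (a + 1)" using p(2) by (meson less_imp_le order_trans)
      from B[OF p(1) this] show ?thesis using p(2) by (meson less_imp_le order_trans)
    qed
    then have "\<forall>n. \<exists>q. q \<in> ?S \<and> ?act q \<le> I + ennreal (1 / real (Suc n)) \<and> (\<forall>t\<in>{0..2*pi}. norm (q 0 t) \<le> B)"
      by blast
    from choice[OF this] obtain q where q: "\<And>n. q n \<in> ?S" "\<And>n. ?act (q n) \<le> I + ennreal (1 / real (Suc n))"
      "\<And>n t. t \<in> {0..2*pi} \<Longrightarrow> norm (q n 0 t) \<le> B"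
      by blast
    have qD: "Lambda_DN N (q n)" for n using q(1)[of n] by (auto intro: Lambda_DN_xi_Lambda_DN)
    have q_in: "in_Lambda N (q n)" for n using qD[of n] by (simp add: Lambda_DN_def)
    have B_all: "norm (q n i t) \<le> B" if "i < N" for n i t
      by (rule Lambda_DN_norm_le[OF qD that q(3)])
    have act_le: "?act (q n) \<le> ennreal (a + 1)" for n
    proof -
      have "I + ennreal (1 / real (Suc n)) \<le> ennreal (a + 1)"
        using a by (simp add: ennreal_leI flip: ennreal_plus)
      then show ?thesis using q(2)[of n] by (rule order_trans[rotated])
    qed
    define C where "C = 2 * (2 * (a + 1)) + 2 * (2*pi * (\<bar>\<omega>\<bar> * B)\<^sup>2)"
    have C: "energy period_measure (wderiv (q n i)) \<le> C" if "i < N" for n i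
      unfolding C_def
      using energy_rot_vel_le_action[OF q_in act_le _ that] a(1)
      by (intro energy_wderiv_le[where \<omega>=\<omega>] Lambda_DN_H1_loop[OF qD that] B_all[OF that]) auto
    obtain r Q where rQ: "strict_mono (r :: nat \<Rightarrow> nat)" "Lambda_DN N Q"
      "\<And>i t. i < N \<Longrightarrow> (\<lambda>n. q (r n) i t) \<longlonglongrightarrow> Q i t"
      using Lambda_DN_compactness[of N q C B, OF N qD C q(3)] by blast
    have "Q \<in> Lambda_DN_xi N \<xi>"
      unfolding Lambda_DN_xi_def
      using q(1) by (intro weak_closure_DN_limit[of "\<lambda>n. q (r n)" N _ Q C B] rQ C B_all) (auto simp: Lambda_DN_xi_def)
    moreover have "P Q"
      using q(1) by (intro closed[of "\<lambda>n. q (r n)" Q B] qD rQ(2) B_all[OF N] rQ(3)[OF N]) auto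
    moreover have "?act Q \<le> I"
    proof (rule action_lower_semicontinuous[of N "\<lambda>n. q (r n)" C B])
      have "(\<lambda>n. ?act (q n)) \<longlonglongrightarrow> I"
      proof (rule tendsto_sandwich)
        show "(\<lambda>n. I) \<longlonglongrightarrow> I" by simp
        have "(\<lambda>n. I + ennreal (1 / real (Suc n))) \<longlonglongrightarrow> I + ennreal 0"
          by (intro tendsto_add tendsto_const tendsto_ennrealI LIMSEQ_Suc[OF lim_1_over_n])
        then show "(\<lambda>n. I + ennreal (1 / real (Suc n))) \<longlonglongrightarrow> I" by simp
      qed (use I_le[OF q(1)] q(2) in auto)
      then show "(\<lambda>n. ?act (q (r n))) \<longlonglongrightarrow> I"
        using LIMSEQ_subseq_LIMSEQ[OF _ rQ(1)] by (fastforce simp: o_def)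
    qed (use q_in C B_all rQ(3) in auto)
    ultimately show ?thesis using I_le by (intro bexI[of _ Q]) (auto intro: order_trans)
  qed
qed

section \<open>Invariance under common rotations for integral angular velocity\<close>

text \<open>A solution of \<zeta>' = - \<i>N\<zeta>. It repeats after time \<open>2*pi / N\<close>,
  so the shifts of the choreography leave it alone and all bodies are displaced by the same vector;
  a real \<open>c\<close> respects the reflection.\<close>

definition spin :: "nat \<Rightarrow> real \<Rightarrow> real \<Rightarrow> complex \<times> real" where
  "spin N c t = (complex_of_real c * cis (- (real N * t)), 0)"

lemma cis_shift: "cis (x + 2*pi * of_int k) = cis x"
  by (simp flip: cis_mult)

lemma spin_shift: "spin N c (t + 2*pi * real i / real N) = spin N c t" if "0 < N"
proof -
  have "- (real N * (t + 2*pi * real i / real N)) = - (real N * t) + 2*pi * of_int (- int i)"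
    using that by (simp add: field_simps)
  then show ?thesis by (simp only: spin_def cis_shift)
qed

lemma spin_periodic: "spin N c (t + 2*pi) = spin N c t"
proof -
  have "- (real N * (t + 2*pi)) = - (real N * t) + 2*pi * of_int (- int N)"
    by (simp add: field_simps)
  then show ?thesis by (simp only: spin_def cis_shift)
qed

lemma spin_reflect: "spin N c (2*pi - t) = refl_xz (spin N c t)"
proof -
  have "- (real N * (2*pi - t)) = real N * t + 2*pi * of_int (- int N)"
    by (simp add: field_simps)
  then have "cis (- (real N * (2*pi - t))) = cis (real N * t)" by (simp only: cis_shift)
  then show ?thesis by (simp add: spin_def refl_xz_def cis_cnj)
qed

lemma spin_wderiv:
  "is_wderiv (spin N c) (\<lambda>t. - (\<i> * complex_of_real (real N) * fst (spin N c t), 0))"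
proof (rule is_wderiv_C1)
  have "((\<lambda>t. cis (- (real N * t))) has_vector_derivative - (\<i> * complex_of_real (real N) * cis (- (real N * t)))) (at t)" for t
    unfolding has_vector_derivative_def
    by (auto intro!: derivative_eq_intros simp: scaleR_conv_of_real)
  from has_vector_derivative_Pair[OF has_vector_derivative_mult_right[OF this, of "complex_of_real c"]
      has_vector_derivative_const[of "0::real"]]
  show "(spin N c has_vector_derivative - (\<i> * complex_of_real (real N) * fst (spin N c t), 0)) (at t)" for t
    unfolding spin_def by (rule has_vector_derivative_eq_rhs) (simp add: mult_ac)
  show "continuous_on UNIV (\<lambda>t. - (\<i> * complex_of_real (real N) * fst (spin N c t), 0::real))"
    unfolding spin_def by (auto intro!: continuous_intros)
qed

lemma H1_loop_spin: "H1_loop (spin N c)"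
  unfolding H1_loop_def using spin_periodic spin_wderiv by blast

lemma H1_loop_add: "H1_loop f \<Longrightarrow> H1_loop g \<Longrightarrow> H1_loop (\<lambda>t. f t + g t)"
  unfolding H1_loop_def using is_wderiv_add by metis

lemma in_Lambda_add_spin: "in_Lambda N q \<Longrightarrow> in_Lambda N (\<lambda>i t. q i t + spin N c t)"
  unfolding in_Lambda_def by (intro allI impI H1_loop_add H1_loop_spin) blast

lemma Lambda_DN_add_spin:
  assumes "0 < N" "Lambda_DN N q"
  shows "Lambda_DN N (\<lambda>i t. q i t + spin N c t)"
proof -
  have "q i t + spin N c t = q 0 (t + 2*pi * real i / real N) + spin N c (t + 2*pi * real i / real N)"
    if "i < N" for i t
  proof -
    have "q i t = q 0 (t + 2*pi * real i / real N)" using assms(2) that unfolding Lambda_DN_def by blast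
    then show ?thesis by (simp only: spin_shift[OF assms(1)])
  qed
  moreover have "q 0 (2*pi - t) + spin N c (2*pi - t) = refl_xz (q 0 t + spin N c t)" for t
  proof -
    have "q 0 (2*pi - t) = refl_xz (q 0 t)" using assms(2) unfolding Lambda_DN_def by blast
    then show ?thesis by (simp add: spin_reflect refl_xz_def)
  qed
  moreover have "in_Lambda N (\<lambda>i t. q i t + spin N c t)"
    using assms(2) in_Lambda_add_spin unfolding Lambda_DN_def by blast
  ultimately show ?thesis unfolding Lambda_DN_def by blast
qed

text \<open>At the times \<open>k * pi / N\<close> the displacement is real and does not touch the
  signs; differences of bodies, hence collisions, are unaffected.\<close>

lemma DN_core_add_spin:
  assumes N: "0 < N" and q: "q \<in> DN_core N \<xi>"
  shows "(\<lambda>i t. q i t + spin N c t) \<in> DN_core N \<xi>"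
proof -
  have "Im (fst (spin N c (real k * pi / real N))) = 0" for k
    using N by (simp add: spin_def)
  then show ?thesis
    using q Lambda_DN_add_spin[OF N] unfolding DN_core_def collision_free_def by simp
qed

text \<open>The contribution of the displacement is independent of \<open>q\<close>, so it cancels
  in differences of pairings. Additivity of \<open>wderiv\<close> holds only a.e. and is used under
  the integral.\<close>

lemma H1_inner_add_spin:
  assumes q: "in_Lambda N q" and h: "in_Lambda N h"
  shows "H1_inner N (\<lambda>i t. q i t + spin N c t) h = H1_inner N q h + H1_inner N (\<lambda>i. spin N c) h"
  unfolding H1_inner_def sum.distrib[symmetric]
proof (intro sum.cong refl)
  fix i assume "i \<in> {..<N}"
  then have qi: "H1_loop (q i)" and hi: "H1_loop (h i)" using q h by (auto simp: in_Lambda_def)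
  let ?f = "\<lambda>t. q i t + spin N c t"
  note sqi = sq_integrable_inner[OF sq_integrable_H1_loop sq_integrable_H1_loop[OF hi]]
    sq_integrable_inner[OF sq_integrable_wderiv sq_integrable_wderiv[OF hi]]
  have f: "H1_loop ?f" by (rule H1_loop_add[OF qi H1_loop_spin])
  have int: "integrable period_measure (\<lambda>t. u t \<bullet> h i t + wderiv u t \<bullet> wderiv (h i) t)" if "H1_loop u" for u
    using sqi[OF that] by simp
  have "AE t in period_measure. wderiv ?f t = wderiv (q i) t + wderiv (spin N c) t"
    by (rule wderiv_AE_eq[OF is_wderiv_add[OF H1_loop_wderiv[OF qi] H1_loop_wderiv[OF H1_loop_spin]]])
  then have ae: "AE t in period_measure. ?f t \<bullet> h i t + wderiv ?f t \<bullet> wderiv (h i) t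
      = (q i t \<bullet> h i t + wderiv (q i) t \<bullet> wderiv (h i) t)
        + (spin N c t \<bullet> h i t + wderiv (spin N c) t \<bullet> wderiv (h i) t)"
    by eventually_elim (simp add: inner_add_left)
  have "(\<integral>t. ?f t \<bullet> h i t + wderiv ?f t \<bullet> wderiv (h i) t \<partial>period_measure)
      = (\<integral>t. (q i t \<bullet> h i t + wderiv (q i) t \<bullet> wderiv (h i) t)
        + (spin N c t \<bullet> h i t + wderiv (spin N c) t \<bullet> wderiv (h i) t) \<partial>period_measure)"
    using int[OF f] int[OF qi] int[OF H1_loop_spin] ae by (intro integral_cong_AE) auto
  also have "\<dots> = (\<integral>t. q i t \<bullet> h i t + wderiv (q i) t \<bullet> wderiv (h i) t \<partial>period_measure)
      + (\<integral>t. spin N c t \<bullet> h i t + wderiv (spin N c) t \<bullet> wderiv (h i) t \<partial>period_measure)"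
    by (intro Bochner_Integration.integral_add int qi H1_loop_spin)
  finally show "(LINT t:{0..2*pi}|lborel. ?f t \<bullet> h i t + wderiv ?f t \<bullet> wderiv (h i) t)
      = (LINT t:{0..2*pi}|lborel. q i t \<bullet> h i t + wderiv (q i) t \<bullet> wderiv (h i) t)
      + (LINT t:{0..2*pi}|lborel. spin N c t \<bullet> h i t + wderiv (spin N c) t \<bullet> wderiv (h i) t)"
    by (simp only: set_integral_period)
qed

text \<open>The displacement cancels in \<open>H1_inner N p h - H1_inner N q h\<close>, so
  displacing an approximating \<open>p\<close> works with the same test loops and the same
  \<open>\<epsilon>\<close>.\<close>

lemma Lambda_DN_xi_add_spin:
  assumes N: "0 < N" and q: "q \<in> Lambda_DN_xi N \<xi>"
  shows "(\<lambda>i t. q i t + spin N c t) \<in> Lambda_DN_xi N \<xi>"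
  unfolding Lambda_DN_xi_def weak_closure_DN_def
proof (intro CollectI conjI allI impI)
  have qD: "Lambda_DN N q" by (rule Lambda_DN_xi_Lambda_DN[OF q])
  then show "Lambda_DN N (\<lambda>i t. q i t + spin N c t)" by (rule Lambda_DN_add_spin[OF N])
  fix H and \<epsilon> :: real assume H: "finite H" "H \<subseteq> {h. in_Lambda N h}" "0 < \<epsilon>"
  have "\<exists>p\<in>DN_core N \<xi>. \<forall>h\<in>H. \<bar>H1_inner N p h - H1_inner N q h\<bar> < \<epsilon>"
    using q H unfolding Lambda_DN_xi_def weak_closure_DN_def by blast
  then obtain p where p: "p \<in> DN_core N \<xi>" "\<And>h. h \<in> H \<Longrightarrow> \<bar>H1_inner N p h - H1_inner N q h\<bar> < \<epsilon>"
    by blast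
  have in_p: "in_Lambda N p" using p(1) by (simp add: DN_core_def Lambda_DN_def)
  have in_q: "in_Lambda N q" using qD by (simp add: Lambda_DN_def)
  have "\<bar>H1_inner N (\<lambda>i t. p i t + spin N c t) h - H1_inner N (\<lambda>i t. q i t + spin N c t) h\<bar> < \<epsilon>"
    if "h \<in> H" for h
    using p(2)[OF that] H(2) that H1_inner_add_spin[OF in_p, of h c] H1_inner_add_spin[OF in_q, of h c] by auto
  then show "\<exists>p\<in>DN_core N \<xi>. \<forall>h\<in>H. \<bar>H1_inner N p h - H1_inner N (\<lambda>i t. q i t + spin N c t) h\<bar> < \<epsilon>"
    using DN_core_add_spin[OF N p(1)] by blast
qed

lemma energy_AE_cong:
  assumes "sq_integrable M f" "sq_integrable M g" "AE x in M. f x = g x"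
  shows "energy M f = energy M g"
  unfolding energy_def
  using assms by (intro integral_cong_AE) (auto dest!: sq_integrable_measurable elim: eventually_mono)

text \<open>The Coriolis term of the displacement cancels its derivative, and the potential depends
  on differences only.\<close>

lemma action_add_spin:
  assumes q: "in_Lambda N q"
  shows "action N (real N) (\<lambda>i t. q i t + spin N c t) 0 (2*pi) = action N (real N) q 0 (2*pi)"
proof -
  have "energy period_measure (rot_vel (real N) (\<lambda>t. q i t + spin N c t)) = energy period_measure (rot_vel (real N) (q i))"
    if i: "i < N" for i
  proof (rule energy_AE_cong)
    have qi: "H1_loop (q i)" using q i by (simp add: in_Lambda_def)
    show "sq_integrable period_measure (rot_vel (real N) (\<lambda>t. q i t + spin N c t))"
      by (intro sq_integrable_rot_vel H1_loop_add qi H1_loop_spin)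
    show "sq_integrable period_measure (rot_vel (real N) (q i))"
      by (intro sq_integrable_rot_vel qi)
    have "AE t in period_measure. wderiv (\<lambda>t. q i t + spin N c t) t =
        wderiv (q i) t + - (\<i> * complex_of_real (real N) * fst (spin N c t), 0)"
      by (rule wderiv_AE_eq[OF is_wderiv_add[OF H1_loop_wderiv[OF qi] spin_wderiv]])
    then show "AE t in period_measure. rot_vel (real N) (\<lambda>t. q i t + spin N c t) t = rot_vel (real N) (q i) t"
      by eventually_elim (simp add: rot_vel_def prod_eq_iff algebra_simps)
  qed
  moreover have "potential N (\<lambda>i. q i t + spin N c t) = potential N (\<lambda>i. q i t)" for t
    by (simp add: potential_eq)
  ultimately show ?thesis
    unfolding action_eq[OF q] action_eq[OF in_Lambda_add_spin[OF q]] by simp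
qed

lemma mean_z0_add_spin: "mean_z0 (\<lambda>i t. q i t + spin N c t) = mean_z0 q"
  by (simp add: mean_z0_def spin_def)

lemma mean_x0_add_spin:
  assumes N: "0 < N" and q: "Lambda_DN N q"
  shows "mean_x0 (\<lambda>i t. q i t + spin N c t) = mean_x0 q"
proof -
  have q0: "H1_loop (q 0)" by (rule Lambda_DN_H1_loop[OF q N])
  have "is_wderiv (\<lambda>t. c * sin (real N * t) / real N) (\<lambda>t. c * cos (real N * t))"
    using N by (intro is_wderiv_C1) (auto intro!: derivative_eq_intros continuous_intros
        simp flip: has_real_derivative_iff_has_vector_derivative)
  from is_wderiv_integral[OF this, of 0 "2*pi"]
  have zero: "(LINT t:{0..2*pi}|lborel. c * cos (real N * t)) = 0"
    using sin_int_2pin[of "int N"] by (simp add: mult_ac)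
  have "(LINT t:{0..2*pi}|lborel. Re (fst (q 0 t + spin N c t)))
      = (LINT t:{0..2*pi}|lborel. Re (fst (q 0 t)) + c * cos (real N * t))"
    by (simp add: spin_def)
  also have "\<dots> = (LINT t:{0..2*pi}|lborel. Re (fst (q 0 t))) + (LINT t:{0..2*pi}|lborel. c * cos (real N * t))"
    by (intro set_integral_add(2) borel_integrable_atLeastAtMost' continuous_intros H1_loop_continuous_on q0)
  finally show ?thesis unfolding mean_x0_def zero by simp
qed

section \<open>A priori bounds\<close>

lemma energy_mono:
  assumes "sq_integrable M f" "sq_integrable M g" "\<And>x. norm (f x) \<le> norm (g x)"
  shows "energy M f \<le> energy M g"
  unfolding energy_def
  by (intro integral_mono sq_integrable_norm_square assms(1,2) power_mono assms(3)) simp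

lemma norm_snd_le_norm: "norm (snd p) \<le> norm p" and norm_fst_le_norm: "norm (fst p) \<le> norm p"
  using norm_snd_le[of "snd p" "fst p"] norm_fst_le[of "fst p" "snd p"] by simp_all

text \<open>The time reversal fixes 0 modulo the period, so \<open>q 0 0\<close> lies in the
  xz-plane. Hence a bound on x alone bounds the planar starting point, and a real multiple of the
  spin can cancel it.\<close>

lemma Lambda_DN_start_real:
  assumes "0 < N" "Lambda_DN N q" shows "Im (fst (q 0 0)) = 0"
proof -
  have "q 0 (2*pi) = q 0 0"
    using H1_loop_periodic[OF Lambda_DN_H1_loop[OF assms(2,1)], of 0 1] by simp
  moreover have "q 0 (2*pi - 0) = refl_xz (q 0 0)"
    using assms(2) unfolding Lambda_DN_def by blast
  ultimately have "q 0 0 = refl_xz (q 0 0)" by simp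
  then have "fst (q 0 0) = cnj (fst (q 0 0))" by (metis fst_conv refl_xz_def)
  then show ?thesis by (simp add: complex_eq_iff)
qed

context
  fixes N :: nat and q :: loop and \<omega> A \<eta> :: real
  assumes N: "0 < N" and q: "Lambda_DN N q" and \<omega>: "0 \<le> \<omega>" and A: "0 \<le> A"
    and act: "action N \<omega> q 0 (2*pi) \<le> ennreal A" and \<eta>: "\<eta> = sqrt (2*pi * (2 * A))"
begin

text \<open>\<open>\<eta>\<close> combines the length \<open>2*pi\<close> of the period with the
  bound \<open>2 * A\<close> on the energy of the rotating velocity; a component dominated by that
  velocity inherits the bound.\<close>

lemma action_bound_component:
  assumes f: "is_wderiv f g" and le: "\<And>t. norm (g t) \<le> norm (rot_vel \<omega> (q 0) t)"
  shows "sqrt (2*pi * energy period_measure g) \<le> \<eta>"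
proof -
  have q0: "H1_loop (q 0)" by (rule Lambda_DN_H1_loop[OF q N])
  have "in_Lambda N q" using q by (simp add: Lambda_DN_def)
  then have "energy period_measure (rot_vel \<omega> (q 0)) \<le> 2 * A"
    by (rule energy_rot_vel_le_action[OF _ act A N])
  moreover have "energy period_measure g \<le> energy period_measure (rot_vel \<omega> (q 0))"
    by (rule energy_mono[OF is_wderiv_sq_integrable[OF f] sq_integrable_rot_vel[OF q0] le])
  ultimately show ?thesis unfolding \<eta> by (intro real_sqrt_le_mono mult_left_mono) auto
qed

lemma action_bound_rotating:
  shows "t \<in> {0..2*pi} \<Longrightarrow> cmod (fst (q 0 t)) \<le> cmod (fst (q 0 0)) + (1 + 2*pi*\<omega>) * \<eta>"
    and "cmod (exp (\<i> * complex_of_real (2*pi*\<omega>)) - 1) * cmod (fst (q 0 0)) \<le> (1 + 2*pi*\<omega>) * \<eta>"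
proof -
  have q0: "H1_loop (q 0)" by (rule Lambda_DN_H1_loop[OF q N])
  have "in_Lambda N q" using q by (simp add: Lambda_DN_def)
  then have e1: "energy period_measure (rot_vel \<omega> (q 0)) \<le> 2 * A"
    by (rule energy_rot_vel_le_action[OF _ act A N])
  let ?h = "\<lambda>t. fst (wderiv (q 0) t) + \<i> * complex_of_real \<omega> * fst (q 0 t)"
  have h: "?h = (\<lambda>t. fst (rot_vel \<omega> (q 0) t))" by (simp add: rot_vel_def)
  have "energy period_measure ?h \<le> energy period_measure (rot_vel \<omega> (q 0))"
    unfolding h
    by (intro energy_mono sq_integrable_bounded_linear[OF bounded_linear_fst] sq_integrable_rot_vel q0 norm_fst_le_norm)
  then have "sqrt (2*pi * energy period_measure ?h) \<le> \<eta>"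
    unfolding \<eta> using e1 by (intro real_sqrt_le_mono mult_left_mono) auto
  then have le: "(1 + 2*pi*\<omega>) * sqrt (2*pi * energy period_measure ?h) \<le> (1 + 2*pi*\<omega>) * \<eta>"
    using \<omega> by (intro mult_left_mono) auto
  note bounds = rotating_frame_bounds[OF is_wderiv_bounded_linear[OF bounded_linear_fst H1_loop_wderiv[OF q0]] \<omega> refl]
  show "cmod (fst (q 0 t)) \<le> cmod (fst (q 0 0)) + (1 + 2*pi*\<omega>) * \<eta>" if "t \<in> {0..2*pi}"
    using bounds(1)[OF that] le by linarith
  have "q 0 (2*pi) = q 0 0"
    using H1_loop_periodic[OF q0, of 0 1] by simp
  then show "cmod (exp (\<i> * complex_of_real (2*pi*\<omega>)) - 1) * cmod (fst (q 0 0)) \<le> (1 + 2*pi*\<omega>) * \<eta>"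
    using bounds(2) le by simp
qed

text \<open>The planar part contributes \<open>(1 + 2*pi*\<omega>) * \<eta>\<close>, the vertical
  part one more \<open>\<eta>\<close> through its vanishing mean.\<close>

lemma action_bound_norm:
  assumes mean: "mean_z0 q = 0" and t: "t \<in> {0..2*pi}"
  shows "norm (q 0 t) \<le> cmod (fst (q 0 0)) + (2 + 2*pi*\<omega>) * \<eta>"
proof -
  have q0: "H1_loop (q 0)" by (rule Lambda_DN_H1_loop[OF q N])
  have z: "is_wderiv (\<lambda>t. snd (q 0 t)) (\<lambda>t. snd (wderiv (q 0) t))"
    by (rule is_wderiv_bounded_linear[OF bounded_linear_snd H1_loop_wderiv[OF q0]])
  have "snd (wderiv (q 0) t) = snd (rot_vel \<omega> (q 0) t)" for t by (simp add: rot_vel_def)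
  then have "sqrt (2*pi * energy period_measure (\<lambda>t. snd (wderiv (q 0) t))) \<le> \<eta>"
    using norm_snd_le_norm[of "rot_vel \<omega> (q 0) t" for t]
    by (intro action_bound_component[OF z]) (simp only:)
  moreover have "\<bar>snd (q 0 t)\<bar> \<le> sqrt (2*pi * energy period_measure (\<lambda>t. snd (wderiv (q 0) t)))"
    using mean by (intro mean_zero_bound[OF z _ t]) (simp add: mean_z0_def)
  moreover have "norm (q 0 t) \<le> norm (fst (q 0 t)) + norm (snd (q 0 t))"
    using norm_Pair_le[of "fst (q 0 t)" "snd (q 0 t)"] by simp
  ultimately show ?thesis
    using action_bound_rotating(1)[OF t] by (simp add: algebra_simps)
qed

text \<open>For \<omega> = 0 the rotating velocity is the ordinary one, so the vanishing mean of x_0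
  controls x_0(0), and the starting point is real.\<close>

lemma action_bound_start:
  assumes \<omega>0: "\<omega> = 0" and mean: "mean_x0 q = 0"
  shows "cmod (fst (q 0 0)) \<le> \<eta>"
proof -
  have q0: "H1_loop (q 0)" by (rule Lambda_DN_H1_loop[OF q N])
  have L: "bounded_linear (\<lambda>p::complex \<times> real. Re (fst p))"
    by (rule bounded_linear_compose[OF bounded_linear_Re bounded_linear_fst])
  have x: "is_wderiv (\<lambda>t. Re (fst (q 0 t))) (\<lambda>t. Re (fst (wderiv (q 0) t)))"
    by (rule is_wderiv_bounded_linear[OF L H1_loop_wderiv[OF q0]])
  have "norm (Re (fst (wderiv (q 0) t))) \<le> norm (rot_vel \<omega> (q 0) t)" for t
  proof -
    have "norm (Re (fst (wderiv (q 0) t))) \<le> norm (fst (wderiv (q 0) t))"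
      using abs_Re_le_cmod by simp
    also have "\<dots> = norm (fst (rot_vel \<omega> (q 0) t))" by (simp add: rot_vel_def \<omega>0)
    finally show ?thesis using norm_fst_le_norm order_trans by blast
  qed
  then have "sqrt (2*pi * energy period_measure (\<lambda>t. Re (fst (wderiv (q 0) t)))) \<le> \<eta>"
    by (rule action_bound_component[OF x])
  moreover have "\<bar>Re (fst (q 0 0))\<bar> \<le> sqrt (2*pi * energy period_measure (\<lambda>t. Re (fst (wderiv (q 0) t))))"
    using mean by (intro mean_zero_bound[OF x]) (auto simp: mean_x0_def)
  moreover have "cmod (fst (q 0 0)) = \<bar>Re (fst (q 0 0))\<bar>"
    using Lambda_DN_start_real[OF N q] by (simp add: cmod_def)
  ultimately show ?thesis by linarith
qed

end

section \<open>Every sign class contains a collision-free loop\<close>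

text \<open>Newton's scheme: the product \<open>R\<close> vanishes at the old nodes and corrects the
  value at the new one.\<close>

lemma polynomial_interpolation:
  fixes x c :: "'k \<Rightarrow> real"
  assumes "finite K" "inj_on x K"
  shows "\<exists>P. \<forall>k\<in>K. poly P (x k) = c k"
  using assms
proof (induction K rule: finite_induct)
  case (insert a K)
  then obtain P where P: "\<forall>k\<in>K. poly P (x k) = c k" by auto
  define R where "R = (\<Prod>k\<in>K. [:- x k, 1:])"
  have "poly R (x a) \<noteq> 0"
    using insert by (auto simp: R_def poly_prod)
  moreover have "poly R (x k) = 0" if "k \<in> K" for k
    using that insert by (auto simp: R_def poly_prod)
  ultimately have "\<forall>k\<in>insert a K. poly (P + smult ((c a - poly P (x a)) / poly R (x a)) R) (x k) = c k"
    using P by simp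
  then show ?case by blast
qed simp

context
  fixes P :: "real poly"
begin

text \<open>The odd second coordinate and the even height encode the reflection. Staying in the
  plane x = 0 makes the mean of x vanish, and the height \<open>cos s\<close> lets a double point
  pair \<open>s\<close> only with \<open>- s\<close> modulo 2\<pi>; \<open>P\<close> is left free to
  set the signs.\<close>

definition wave :: "real \<Rightarrow> complex \<times> real" where
  "wave s = (complex_of_real (sin s * poly P (cos s)) * \<i>, cos s)"

lemma wave_shift_int: "wave (s + 2*pi * of_int k) = wave s"
  by (rule periodic_shift_int) (simp add: wave_def)

lemma wave_uminus: "wave (- s) = refl_xz (wave s)"
  by (simp add: wave_def refl_xz_def)

lemma H1_loop_wave: "H1_loop (\<lambda>t. wave (t + a))"
  unfolding H1_loop_def
proof (intro conjI allI exI)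
  show "wave (t + 2*pi + a) = wave (t + a)" for t
    using wave_shift_int[of "t + a" 1] by (simp add: algebra_simps)
  let ?y = "\<lambda>s. cos s * poly P (cos s) - sin s * (poly (pderiv P) (cos s) * sin s)"
  show "is_wderiv (\<lambda>t. wave (t + a)) (\<lambda>t. (complex_of_real (?y (t + a)) * \<i>, - sin (t + a)))"
  proof (rule is_wderiv_C1)
    fix t
    have "((\<lambda>t. sin (t + a) * poly P (cos (t + a))) has_real_derivative ?y (t + a)) (at t)"
      by (auto intro!: derivative_eq_intros DERIV_chain2[OF poly_DERIV])
    then have y: "((\<lambda>t. complex_of_real (sin (t + a) * poly P (cos (t + a))) * \<i>)
        has_vector_derivative complex_of_real (?y (t + a)) * \<i>) (at t)"
      by (intro has_vector_derivative_mult_left has_vector_derivative_of_real)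
         (simp add: has_real_derivative_iff_has_vector_derivative)
    have "((\<lambda>t. cos (t + a)) has_real_derivative - sin (t + a)) (at t)"
      by (auto intro!: derivative_eq_intros)
    then show "((\<lambda>t. wave (t + a)) has_vector_derivative (complex_of_real (?y (t + a)) * \<i>, - sin (t + a))) (at t)"
      unfolding wave_def
      by (intro has_vector_derivative_Pair y) (simp add: has_real_derivative_iff_has_vector_derivative)
  qed (auto intro!: continuous_intros)
qed

lemma Lambda_DN_wave: "Lambda_DN N (\<lambda>i t. wave (t + 2*pi * real i / real N))"
proof -
  have "wave (2*pi - t + 2*pi * real 0 / real N) = refl_xz (wave (t + 2*pi * real 0 / real N))" for t
    using wave_shift_int[of "- t" 1] wave_uminus[of t] by simp
  moreover have "wave (t + 2*pi * real i / real N) = wave (t + 2*pi * real i / real N + 2*pi * real 0 / real N)" for t i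
    by simp
  ultimately show ?thesis
    unfolding Lambda_DN_def in_Lambda_def using H1_loop_wave by blast
qed

text \<open>If \<open>cos s = cos s'\<close> at a collision of two bodies, then \<open>s' = - s\<close> modulo \<open>2\<pi>\<close>; hence \<open>s\<close> is a
  multiple of \<open>\<pi> / N\<close> and the odd second coordinate vanishes there.\<close>

lemma collision_free_wave:
  assumes N: "0 < N" and P: "\<And>k. k \<in> {1..N-1} \<Longrightarrow> poly P (cos (real k * pi / real N)) \<noteq> 0"
  shows "collision_free N (\<lambda>i t. wave (t + 2*pi * real i / real N))"
  unfolding collision_free_def
proof (intro allI impI notI)
  fix t i j assume i: "i < N" and j: "j < N" and "i \<noteq> j"
    and eq: "wave (t + 2*pi * real i / real N) = wave (t + 2*pi * real j / real N)"
  define s s' where "s = t + 2*pi * real i / real N" and "s' = t + 2*pi * real j / real N"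
  have diff: "s - s' = 2*pi * of_int (int i - int j) / real N"
    unfolding s_def s'_def by (simp add: diff_divide_distrib algebra_simps)
  have not_dvd: "\<not> int N dvd int i - int j"
  proof
    assume "int N dvd int i - int j"
    then have "int N \<le> \<bar>int i - int j\<bar>" using \<open>i \<noteq> j\<close> by (intro dvd_imp_le_int[of _ "int N", simplified]) auto
    then show False using i j by linarith
  qed
  have "cos s = cos s'" using eq by (simp add: wave_def s_def s'_def)
  then obtain n :: int where n: "s = s' + 2 * of_int n * pi \<or> s = - s' + 2 * of_int n * pi"
    unfolding cos_eq by (auto elim: Ints_cases)
  then show False
  proof
    assume "s = s' + 2 * of_int n * pi"
    then have "2*pi * of_int (int i - int j) / real N = 2*pi * of_int n" using diff by (simp add: mult_ac)
    then have "real_of_int (int i - int j) / real N = of_int n"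
      unfolding times_divide_eq_right[symmetric] by (simp only: mult_cancel_left) auto
    then have "real_of_int (int i - int j) = real_of_int (n * int N)"
      using N by (simp add: divide_eq_eq)
    then have "int i - int j = n * int N" by (simp only: of_int_eq_iff)
    then show False using not_dvd by simp
  next
    assume s: "s = - s' + 2 * of_int n * pi"
    \<comment> \<open>At \<open>- s'\<close> the curve takes the mirror image of its value at
      \<open>s'\<close>, so \<open>wave s\<close> is its own mirror image and its second coordinate
      is 0.\<close>
    have "wave s = wave (- s' + 2*pi * of_int n)" using s by (simp add: mult_ac)
    also have "\<dots> = refl_xz (wave s')" by (simp only: wave_shift_int wave_uminus)
    also have "\<dots> = refl_xz (wave s)" using eq by (simp add: s_def s'_def)
    finally have "fst (wave s) = cnj (fst (wave s))" by (metis fst_conv refl_xz_def)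
    then have zero: "sin s * poly P (cos s) = 0" by (simp add: wave_def complex_eq_iff)
    \<comment> \<open>Adding \<open>s + s' = 2 * of_int n * pi\<close> to the known difference
      \<open>s - s'\<close> gives \<open>s = of_int m * pi / real N\<close>.\<close>
    define m where "m = n * int N + (int i - int j)"
    have m_dvd: "\<not> int N dvd m" using not_dvd by (simp add: m_def dvd_add_right_iff)
    have s_eq: "s = of_int m * pi / real N"
    proof -
      have "s = of_int n * pi + pi * of_int (int i - int j) / real N"
        using s diff by argo
      then show ?thesis using N by (simp add: m_def add_divide_distrib distrib_right distrib_left mult.commute[of pi])
    qed
    have "sin s \<noteq> 0"
    proof
      assume "sin s = 0"
      then obtain l :: int where "s = of_int l * pi" by (auto simp: sin_zero_iff_int2)
      then have "pi * (real_of_int m / real N) = pi * of_int l" using s_eq by (simp add: mult.commute)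
      then have "real_of_int m / real N = of_int l" by (simp only: mult_cancel_left) auto
      then have "real_of_int m = real_of_int (l * int N)" using N by (simp add: divide_eq_eq)
      then have "m = l * int N" by (simp only: of_int_eq_iff)
      then show False using m_dvd by simp
    qed
    moreover have "poly P (cos s) \<noteq> 0"
    proof -
      \<comment> \<open>One period of \<open>cos\<close> consists of \<open>2 * N\<close> steps of
        length \<open>pi / N\<close>.\<close>
      define r where "r = m mod (2 * int N)"
      have r: "0 \<le> r" "r < 2 * int N" using N by (simp_all add: r_def)
      have r_dvd: "\<not> int N dvd r" using m_dvd by (simp add: r_def dvd_mod_iff)
      have m_eq: "m = r + 2 * int N * (m div (2 * int N))" by (simp add: r_def)
      have "s = of_int r * pi / real N + 2*pi * of_int (m div (2 * int N))"
      proof -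
        have "real_of_int m = of_int r + 2 * real N * of_int (m div (2 * int N))"
          by (subst m_eq) simp
        then show ?thesis unfolding s_eq using N by (simp add: add_divide_distrib distrib_right)
      qed
      then have cos_s: "cos s = cos (of_int r * pi / real N)"
        using periodic_shift_int[of cos "of_int r * pi / real N"] by simp
      have r0: "r \<noteq> 0" "r \<noteq> int N" using r_dvd by auto
      obtain k :: nat where k: "k \<in> {1..N-1}" "cos s = cos (real k * pi / real N)"
      proof (cases "r < int N")
        case True
        have "nat r \<in> {1..N-1}" using True r r0 by auto
        moreover have "real (nat r) = of_int r" using r by simp
        ultimately show ?thesis using that[of "nat r"] cos_s by simp
      next
        case False
        \<comment> \<open>Evenness of \<open>cos\<close> folds the residues between \<open>N\<close>
          and \<open>2 * N\<close> back into \<open>{1..N-1}\<close>.\<close>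
        have "nat (2 * int N - r) \<in> {1..N-1}" using False r r0 N by auto
        moreover have "real (nat (2 * int N - r)) = 2 * real N - of_int r" using r by simp
        moreover have "cos ((2 * real N - of_int r) * pi / real N) = cos (of_int r * pi / real N)"
        proof -
          have "(2 * real N - of_int r) * pi / real N = - (of_int r * pi / real N) + 2*pi * of_int 1"
            using N by (simp add: diff_divide_distrib left_diff_distrib)
          then show ?thesis by (simp only: periodic_shift_int[of cos, OF cos_periodic] cos_minus)
        qed
        ultimately show ?thesis using that[of "nat (2 * int N - r)"] cos_s by simp
      qed
      then show ?thesis using P by simp
    qed
    ultimately show False using zero by simp
  qed
qed

end

text \<open>\<open>cos\<close> is injective between 0 and \<pi>, so \<open>P\<close> can be
  prescribed at the nodes \<open>cos (k * pi / N)\<close>. There \<open>sin\<close> is positive, so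
  the second coordinate has the sign \<open>\<xi> k\<close>; the same nonzero values exclude
  collisions.\<close>

lemma DN_core_nonempty:
  assumes N: "0 < N" and \<xi>: "\<forall>k\<in>{1..N-1}. \<xi> k \<in> {-1, 1::real}"
  obtains q where "q \<in> DN_core N \<xi>" "mean_x0 q = 0" "mean_z0 q = 0"
proof -
  have angle: "0 < real k * pi / real N" "real k * pi / real N < pi" if "k \<in> {1..N-1}" for k
  proof -
    have "real k < real N" using that N by auto
    then have "real k * pi < pi * real N" by simp
    then show "real k * pi / real N < pi" using N by (simp add: pos_divide_less_eq)
    show "0 < real k * pi / real N" using that N by simp
  qed
  have "inj_on (\<lambda>k. cos (real k * pi / real N)) {1..N-1}"
  proof (rule inj_onI)
    fix k l assume k: "k \<in> {1..N-1}" and l: "l \<in> {1..N-1}"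
      and eq: "cos (real k * pi / real N) = cos (real l * pi / real N)"
    have "real k * pi / real N = real l * pi / real N"
      by (rule cos_inj_pi[OF _ _ _ _ eq]) (use angle[OF k] angle[OF l] in linarith)+
    then show "k = l" using N by simp
  qed
  then obtain P where P: "\<And>k. k \<in> {1..N-1} \<Longrightarrow> poly P (cos (real k * pi / real N)) = \<xi> k"
    using polynomial_interpolation[of "{1..N-1}" "\<lambda>k. cos (real k * pi / real N)" \<xi>] by blast
  define q :: loop where "q i t = wave P (t + 2*pi * real i / real N)" for i t
  have "Lambda_DN N q" unfolding q_def by (rule Lambda_DN_wave)
  moreover have "collision_free N q"
  proof -
    have "poly P (cos (real k * pi / real N)) \<noteq> 0" if "k \<in> {1..N-1}" for k
      using P[OF that] \<xi> that by force
    then show ?thesis unfolding q_def by (rule collision_free_wave[OF N])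
  qed
  moreover have "sgn (Im (fst (q 0 (real k * pi / real N)))) = \<xi> k" if k: "k \<in> {1..N-1}" for k
  proof -
    have "Im (fst (q 0 (real k * pi / real N))) = sin (real k * pi / real N) * \<xi> k"
      using P[OF k] by (simp add: q_def wave_def)
    moreover have "0 < sin (real k * pi / real N)"
      using angle[OF k] by (rule sin_gt_zero)
    moreover have "\<xi> k = 1 \<or> \<xi> k = -1" using \<xi> k by blast
    ultimately show ?thesis by (auto simp: sgn_mult)
  qed
  ultimately have "q \<in> DN_core N \<xi>" by (simp add: DN_core_def)
  moreover have "mean_x0 q = 0" by (simp add: mean_x0_def q_def wave_def)
  moreover have "mean_z0 q = 0"
  proof -
    have "is_wderiv sin (cos :: real \<Rightarrow> real)"
      by (intro is_wderiv_C1) (auto intro!: derivative_eq_intros continuous_intros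
          simp flip: has_real_derivative_iff_has_vector_derivative)
    from is_wderiv_integral[OF this, of 0 "2*pi"] show ?thesis
      by (simp add: mean_z0_def q_def wave_def)
  qed
  ultimately show ?thesis using that by blast
qed

lemma DN_core_subset_Lambda_DN_xi: "DN_core N \<xi> \<subseteq> Lambda_DN_xi N \<xi>"
proof
  fix q assume q: "q \<in> DN_core N \<xi>"
  then have "Lambda_DN N q" by (simp add: DN_core_def)
  moreover have "\<exists>p\<in>DN_core N \<xi>. \<forall>h\<in>H. \<bar>H1_inner N p h - H1_inner N q h\<bar> < \<epsilon>" if "\<epsilon> > 0" for H \<epsilon>
    using q that by (intro bexI[of _ q]) auto
  ultimately show "q \<in> Lambda_DN_xi N \<xi>"
    unfolding Lambda_DN_xi_def weak_closure_DN_def by blast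
qed

lemma Lambda_DN_xi_nonempty:
  assumes "0 < N" "\<forall>k\<in>{1..N-1}. \<xi> k \<in> {-1, 1}"
  shows "\<exists>q\<in>Lambda_DN_xi N \<xi>. mean_x0 q = 0 \<and> mean_z0 q = 0"
proof -
  obtain q where "q \<in> DN_core N \<xi>" "mean_x0 q = 0" "mean_z0 q = 0"
    by (rule DN_core_nonempty[OF assms])
  then show ?thesis using DN_core_subset_Lambda_DN_xi by blast
qed

section \<open>The minimisation theorem\<close>

lemma means_limit:
  assumes N: "0 < N" and q: "\<And>n. Lambda_DN N (q n)" and Q: "Lambda_DN N Q"
    and B: "\<And>n t. norm (q n 0 t) \<le> B" and lim: "\<And>t. (\<lambda>n. q n 0 t) \<longlonglongrightarrow> Q 0 t"
  shows "(\<And>n. mean_x0 (q n) = 0) \<Longrightarrow> mean_x0 Q = 0" and "(\<And>n. mean_z0 (q n) = 0) \<Longrightarrow> mean_z0 Q = 0"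
proof -
  have conv: "(\<lambda>n. \<integral>t. q n 0 t \<bullet> e \<partial>period_measure) \<longlonglongrightarrow> (\<integral>t. Q 0 t \<bullet> e \<partial>period_measure)" for e
    using q Q N
    by (intro inner_integral_bounded_convergence[where B=B] B lim sq_integrable_const finite_period_measure
        sq_integrable_measurable[OF sq_integrable_H1_loop] Lambda_DN_H1_loop)
  have x: "mean_x0 p = 1 / (2*pi) * (\<integral>t. p 0 t \<bullet> (1, 0) \<partial>period_measure)" for p
    by (simp add: mean_x0_def set_integral_period inner_prod_def inner_complex_def)
  have z: "mean_z0 p = 1 / (2*pi) * (\<integral>t. p 0 t \<bullet> (0, 1) \<partial>period_measure)" for p
    by (simp add: mean_z0_def set_integral_period inner_prod_def)
  have "(\<lambda>n. mean_x0 (q n)) \<longlonglongrightarrow> mean_x0 Q" "(\<lambda>n. mean_z0 (q n)) \<longlonglongrightarrow> mean_z0 Q"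
    unfolding x z by (intro tendsto_intros conv)+
  then show "(\<And>n. mean_x0 (q n) = 0) \<Longrightarrow> mean_x0 Q = 0" "(\<And>n. mean_z0 (q n) = 0) \<Longrightarrow> mean_z0 Q = 0"
    by (simp_all add: LIMSEQ_const_iff)
qed

lemma minimiser_nonintegral:
  assumes N: "0 < N" and \<omega>: "0 \<le> \<omega>" "\<omega> \<notin> \<int>" and \<xi>: "\<forall>k\<in>{1..N-1}. \<xi> k \<in> {-1, 1}"
  shows "\<exists>q\<in>{q \<in> Lambda_DN_xi N \<xi>. mean_z0 q = 0}. \<forall>p\<in>{p \<in> Lambda_DN_xi N \<xi>. mean_z0 p = 0}.
    action N \<omega> q 0 (2*pi) \<le> action N \<omega> p 0 (2*pi)"
proof (rule action_minimiser_exists[OF N])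
  show "\<exists>q\<in>Lambda_DN_xi N \<xi>. mean_z0 q = 0"
    using Lambda_DN_xi_nonempty[OF N \<xi>] by blast
  fix A :: real
  \<comment> \<open>The failure of \<open>exp (- \<i>\<omega>t)\<close> to close up after one
    period: positive because \<omega> is not an integer, it is divided out to bound the starting
    point.\<close>
  define e where "e = cmod (exp (\<i> * complex_of_real (2*pi*\<omega>)) - 1)"
  have "e > 0"
  proof -
    have "exp (\<i> * complex_of_real (2*pi*\<omega>)) \<noteq> 1"
    proof
      assume "exp (\<i> * complex_of_real (2*pi*\<omega>)) = 1"
      then obtain n :: int where "2*pi*\<omega> = of_int (2 * n) * pi" by (auto simp: exp_eq_1)
      then have "\<omega> = of_int n" by simp
      then show False using \<omega>(2) by simp
    qed
    then show ?thesis by (simp add: e_def)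
  qed
  \<comment> \<open>\<open>ennreal A\<close> is 0 for negative \<open>A\<close>, so
    \<open>max A 0\<close> covers every real level.\<close>
  define \<eta> where "\<eta> = sqrt (2*pi * (2 * max A 0))"
  have "norm (q 0 t) \<le> (1 + 2*pi*\<omega>) * \<eta> / e + (2 + 2*pi*\<omega>) * \<eta>"
    if q: "q \<in> Lambda_DN_xi N \<xi>" "mean_z0 q = 0" "action N \<omega> q 0 (2*pi) \<le> ennreal A"
      and t: "t \<in> {0..2*pi}" for q t
  proof -
    have act: "action N \<omega> q 0 (2*pi) \<le> ennreal (max A 0)"
      using q(3) by (rule order_trans) (simp add: ennreal_leI)
    have qD: "Lambda_DN N q" by (rule Lambda_DN_xi_Lambda_DN[OF q(1)])
    have "e * cmod (fst (q 0 0)) \<le> (1 + 2*pi*\<omega>) * \<eta>"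
      unfolding e_def by (rule action_bound_rotating(2)[OF N qD \<omega>(1) _ act \<eta>_def]) simp
    then have "cmod (fst (q 0 0)) \<le> (1 + 2*pi*\<omega>) * \<eta> / e"
      using \<open>e > 0\<close> by (simp add: field_simps)
    moreover have "norm (q 0 t) \<le> cmod (fst (q 0 0)) + (2 + 2*pi*\<omega>) * \<eta>"
      by (rule action_bound_norm[OF N qD \<omega>(1) _ act \<eta>_def q(2) t]) simp
    ultimately show ?thesis by linarith
  qed
  then show "\<exists>B. \<forall>q\<in>Lambda_DN_xi N \<xi>. mean_z0 q = 0 \<longrightarrow> action N \<omega> q 0 (2*pi) \<le> ennreal A \<longrightarrow>
      (\<exists>q'\<in>Lambda_DN_xi N \<xi>. mean_z0 q' = 0 \<and> action N \<omega> q' 0 (2*pi) \<le> action N \<omega> q 0 (2*pi) \<and>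
        (\<forall>t\<in>{0..2*pi}. norm (q' 0 t) \<le> B))"
    by blast
qed (rule means_limit(2)[OF N])

lemma minimiser_zero:
  assumes N: "0 < N" and \<xi>: "\<forall>k\<in>{1..N-1}. \<xi> k \<in> {-1, 1}"
  shows "\<exists>q\<in>{q \<in> Lambda_DN_xi N \<xi>. mean_x0 q = 0 \<and> mean_z0 q = 0}.
    \<forall>p\<in>{p \<in> Lambda_DN_xi N \<xi>. mean_x0 p = 0 \<and> mean_z0 p = 0}.
    action N 0 q 0 (2*pi) \<le> action N 0 p 0 (2*pi)"
proof (rule action_minimiser_exists[OF N])
  show "\<exists>q\<in>Lambda_DN_xi N \<xi>. mean_x0 q = 0 \<and> mean_z0 q = 0"
    using Lambda_DN_xi_nonempty[OF N \<xi>] by blast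
  fix A :: real
  define \<eta> where "\<eta> = sqrt (2*pi * (2 * max A 0))"
  have "norm (q 0 t) \<le> 3 * \<eta>"
    if q: "q \<in> Lambda_DN_xi N \<xi>" "mean_x0 q = 0" "mean_z0 q = 0" "action N 0 q 0 (2*pi) \<le> ennreal A"
      and t: "t \<in> {0..2*pi}" for q t
  proof -
    have act: "action N 0 q 0 (2*pi) \<le> ennreal (max A 0)"
      using q(4) by (rule order_trans) (simp add: ennreal_leI)
    have qD: "Lambda_DN N q" by (rule Lambda_DN_xi_Lambda_DN[OF q(1)])
    have "cmod (fst (q 0 0)) \<le> \<eta>"
      by (rule action_bound_start[OF N qD order_refl _ act \<eta>_def refl q(2)]) simp
    moreover have "norm (q 0 t) \<le> cmod (fst (q 0 0)) + (2 + 2*pi*0) * \<eta>"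
      by (rule action_bound_norm[OF N qD order_refl _ act \<eta>_def q(3) t]) simp
    ultimately show ?thesis by simp
  qed
  then show "\<exists>B. \<forall>q\<in>Lambda_DN_xi N \<xi>. mean_x0 q = 0 \<and> mean_z0 q = 0 \<longrightarrow> action N 0 q 0 (2*pi) \<le> ennreal A \<longrightarrow>
      (\<exists>q'\<in>Lambda_DN_xi N \<xi>. (mean_x0 q' = 0 \<and> mean_z0 q' = 0) \<and> action N 0 q' 0 (2*pi) \<le> action N 0 q 0 (2*pi) \<and>
        (\<forall>t\<in>{0..2*pi}. norm (q' 0 t) \<le> B))"
    by blast
qed (use means_limit[OF N] in blast)

text \<open>The constraint \<open>mean_x0 = 0\<close> does not control the kernel \<open>exp (- \<i>Nt)\<close> of the kinetic part, but
  adding a real multiple of it changes neither the action nor the class nor the means.\<close>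

lemma minimiser_N:
  assumes N: "0 < N" and \<xi>: "\<forall>k\<in>{1..N-1}. \<xi> k \<in> {-1, 1}"
  shows "\<exists>q\<in>{q \<in> Lambda_DN_xi N \<xi>. mean_x0 q = 0 \<and> mean_z0 q = 0}.
    \<forall>p\<in>{p \<in> Lambda_DN_xi N \<xi>. mean_x0 p = 0 \<and> mean_z0 p = 0}.
    action N (real N) q 0 (2*pi) \<le> action N (real N) p 0 (2*pi)"
proof (rule action_minimiser_exists[OF N])
  show "\<exists>q\<in>Lambda_DN_xi N \<xi>. mean_x0 q = 0 \<and> mean_z0 q = 0"
    using Lambda_DN_xi_nonempty[OF N \<xi>] by blast
  fix A :: real
  define \<eta> where "\<eta> = sqrt (2*pi * (2 * max A 0))"
  have "\<exists>q'\<in>Lambda_DN_xi N \<xi>. (mean_x0 q' = 0 \<and> mean_z0 q' = 0) \<and>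
      action N (real N) q' 0 (2*pi) \<le> action N (real N) q 0 (2*pi) \<and>
      (\<forall>t\<in>{0..2*pi}. norm (q' 0 t) \<le> (2 + 2*pi*real N) * \<eta>)"
    if q: "q \<in> Lambda_DN_xi N \<xi>" "mean_x0 q = 0" "mean_z0 q = 0" "action N (real N) q 0 (2*pi) \<le> ennreal A" for q
  proof -
    have qD: "Lambda_DN N q" by (rule Lambda_DN_xi_Lambda_DN[OF q(1)])
    then have q_in: "in_Lambda N q" by (simp add: Lambda_DN_def)
    \<comment> \<open>The starting point is real, so this real multiple moves it to 0 and its term
      drops out of the bound.\<close>
    define c where "c = - Re (fst (q 0 0))"
    define q' where "q' = (\<lambda>i t. q i t + spin N c t)"
    have q': "q' \<in> Lambda_DN_xi N \<xi>" unfolding q'_def by (rule Lambda_DN_xi_add_spin[OF N q(1)])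
    then have q'D: "Lambda_DN N q'" by (rule Lambda_DN_xi_Lambda_DN)
    have act_eq: "action N (real N) q' 0 (2*pi) = action N (real N) q 0 (2*pi)"
      unfolding q'_def by (rule action_add_spin[OF q_in])
    have act: "action N (real N) q' 0 (2*pi) \<le> ennreal (max A 0)"
      unfolding act_eq using q(4) by (rule order_trans) (simp add: ennreal_leI)
    have means: "mean_x0 q' = 0" "mean_z0 q' = 0"
      using q(2,3) mean_x0_add_spin[OF N qD] mean_z0_add_spin by (simp_all add: q'_def)
    have start: "fst (q' 0 0) = 0"
      using Lambda_DN_start_real[OF N qD] by (simp add: q'_def spin_def c_def complex_eq_iff)
    have "norm (q' 0 t) \<le> (2 + 2*pi*real N) * \<eta>" if t: "t \<in> {0..2*pi}" for t
    proof -
      have "norm (q' 0 t) \<le> cmod (fst (q' 0 0)) + (2 + 2*pi*real N) * \<eta>"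
        by (rule action_bound_norm[OF N q'D _ _ act \<eta>_def means(2) t]) simp_all
      then show ?thesis by (simp add: start)
    qed
    then show ?thesis using q' means act_eq by auto
  qed
  then show "\<exists>B. \<forall>q\<in>Lambda_DN_xi N \<xi>. mean_x0 q = 0 \<and> mean_z0 q = 0 \<longrightarrow> action N (real N) q 0 (2*pi) \<le> ennreal A \<longrightarrow>
      (\<exists>q'\<in>Lambda_DN_xi N \<xi>. (mean_x0 q' = 0 \<and> mean_z0 q' = 0) \<and>
        action N (real N) q' 0 (2*pi) \<le> action N (real N) q 0 (2*pi) \<and> (\<forall>t\<in>{0..2*pi}. norm (q' 0 t) \<le> B))"
    by blast
qed (use means_limit[OF N] in blast)

theorem mainTheorem3:
  fixes N :: nat and \<omega> :: real and \<xi> :: "nat \<Rightarrow> real"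
  assumes "N \<ge> 2"
    and "0 \<le> \<omega>" and "\<omega> \<le> real N"
    and "\<forall>k\<in>{1..N-1}. \<xi> k \<in> {-1, 1}"
  shows "(\<omega> \<notin> \<int> \<longrightarrow>
           (\<exists>q\<in>{q \<in> Lambda_DN_xi N \<xi>. mean_z0 q = 0}.
              \<forall>p\<in>{p \<in> Lambda_DN_xi N \<xi>. mean_z0 p = 0}.
                action N \<omega> q 0 (2*pi) \<le> action N \<omega> p 0 (2*pi)))
       \<and> (\<omega> \<in> {0, real N} \<longrightarrow>
           (\<exists>q\<in>{q \<in> Lambda_DN_xi N \<xi>. mean_x0 q = 0 \<and> mean_z0 q = 0}.
              \<forall>p\<in>{p \<in> Lambda_DN_xi N \<xi>. mean_x0 p = 0 \<and> mean_z0 p = 0}.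
                action N \<omega> q 0 (2*pi) \<le> action N \<omega> p 0 (2*pi)))"
proof -
  have N: "0 < N" using assms(1) by simp
  show ?thesis
    using minimiser_nonintegral[OF N assms(2) _ assms(4)] minimiser_zero[OF N assms(4)] minimiser_N[OF N assms(4)]
    by blast
qed

end
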